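(* Let $X$ and $Y$ be Banach spaces, let $p,q\in[1,+\infty)$, and let $f:\mathbb{R}\times X\to Y$ be a map. For $u:\mathbb{R}\to X$ put $\mathcal{N}_f(u)(t)=f(t,u(t))$, $t\in\mathbb{R}$. The following assertions are equivalent. (i) The operator $\mathcal{N}_f$ maps $S^p_{aa}(\mathbb{R},X)$ into $S^q_{aa}(\mathbb{R},Y)$, and $\mathcal{N}_f:S^p_{aa}(\mathbb{R},X)\to S^q_{aa}(\mathbb{R},Y)$ is continuous. (ii) The operator $G:L^p_1(\mathbb{R},X)\to S^q_{aa}(\mathbb{R},Y)$ given by $G(u)=\mathcal{N}_f(u)$ for $u\in L^p_1(\mathbb{R},X)$ is well-defined (i.e. $\mathcal{N}_f(u)\in S^q_{aa}(\mathbb{R},Y)$ for all $u\in L^p_1(\mathbb{R},X)$) and continuous. (iii) For all $x\in X$, $f(\cdot,x)\in S^q_{aa}(\mathbb{R},Y)$, and the operator $H:L^p_1(\mathbb{R},X)\to BS^q(\mathbb{R},Y)$ given by $H(u)=\mathcal{N}_f(u)$ for $u\in L^p_1(\mathbb{R},X)$ is well-defined (i.e. $\mathcal{N}_f(u)\in BS^q(\mathbb{R},Y)$ for all $u\in L^p_1(\mathbb{R},X)$) and continuous.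
   Context: For a Banach space $E$ and $1\le p<\infty$: $L^p(a,b;E)$ is the space of Bochner $p$-integrable functions on $(a,b)$ (functions equal a.e. are identified), and $L^p_{loc}(\mathbb{R},E)$ is the space of functions $u:\mathbb{R}\to E$ whose restriction to every bounded interval $(a,b)$ is in $L^p(a,b;E)$. The Bochner transform of $u\in L^p_{loc}(\mathbb{R},E)$ is the (continuous) map $u^b:\mathbb{R}\to L^p(0,1;E)$, $u^b(t)(\theta)=u(t+\theta)$, $\theta\in(0,1)$. $BC(\mathbb{R},E)$ is the space of bounded continuous maps $\mathbb{R}\to E$ with the supremum norm. A continuous function $u:\mathbb{R}\to E$ is almost automorphic if every sequence of real numbers has a subsequence $(t_k)$ for which there is a function $v:\mathbb{R}\to E$ with $\lim_k u(t+t_k)=v(t)$ and $\lim_k v(t-t_k)=u(t)$ for every $t\in\mathbb{R}$; $AA(\mathbb{R},E)\subset BC(\mathbb{R},E)$ denotes the space of such functions. $BS^p(\mathbb{R},E)=\{u\in L^p_{loc}(\mathbb{R},E): u^b\in BC(\mathbb{R},L^p(0,1;E))\}$, a Banach space with norm $\|u\|_{S^p}=\sup_{t\in\mathbb{R}}\left(\int_0^1\|u(t+\theta)\|^p\,d\theta\right)^{1/p}$. $S^p_{aa}(\mathbb{R},E)=\{u\in L^p_{loc}(\mathbb{R},E): u^b\in AA(\mathbb{R},L^p(0,1;E))\}$ (Stepanov almost automorphic functions), a closed subspace of $BS^p(\mathbb{R},E)$ with the same norm. $L^p_1(\mathbb{R},E)=\{u\in L^p_{loc}(\mathbb{R},E):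 u(t+1)=u(t)\text{ for a.e. }t\in\mathbb{R}\}\subset S^p_{aa}(\mathbb{R},E)$, with the norm $\|\cdot\|_{S^p}$, which on this subspace equals $\left(\int_0^1\|u(\theta)\|^p\,d\theta\right)^{1/p}$. *)

theory Defs
  imports "HOL-Analysis.Analysis"
begin

text \<open>
  Elements of the Lebesgue-type spaces below are functions, not classes modulo a.e. equality:
  each space is a set of functions together with its seminorm, and two functions that agree a.e.
  are at seminorm distance \<open>0\<close>. Convergence, continuity and boundedness always refer to the
  seminorm, so they are the corresponding notions of the quotient normed space.
\<close>

section \<open>Maps into and between seminormed spaces\<close>

text \<open>A seminormed space is given by its carrier \<open>M\<close> and its seminorm \<open>N\<close>.\<close>

definition cont_maps :: "'e::minus set \<Rightarrow> ('e \<Rightarrow> real) \<Rightarrow> (real \<Rightarrow> 'e) set" where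
  "cont_maps M N = {w. (\<forall>t. w t \<in> M) \<and> (\<forall>t. ((\<lambda>s. N (w s - w t)) \<longlongrightarrow> 0) (at t))}"

definition BC :: "'e::minus set \<Rightarrow> ('e \<Rightarrow> real) \<Rightarrow> (real \<Rightarrow> 'e) set" where
  "BC M N = {w \<in> cont_maps M N. \<exists>B. \<forall>t. N (w t) \<le> B}"

definition AA :: "'e::minus set \<Rightarrow> ('e \<Rightarrow> real) \<Rightarrow> (real \<Rightarrow> 'e) set" where
  "AA M N = {w \<in> cont_maps M N.
     \<forall>s :: nat \<Rightarrow> real. \<exists>r :: nat \<Rightarrow> nat. strict_mono r \<and>
       (\<exists>v :: real \<Rightarrow> 'e. (\<forall>t. v t \<in> M) \<and>
         (\<forall>t. (\<lambda>k. N (w (t + s (r k)) - v t)) \<longlonglongrightarrow> 0 \<and>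
              (\<lambda>k. N (v (t - s (r k)) - w t)) \<longlonglongrightarrow> 0))}"

definition seminorm_continuous_on ::
    "'d::minus set \<Rightarrow> ('d \<Rightarrow> real) \<Rightarrow> ('e::minus \<Rightarrow> real) \<Rightarrow> ('d \<Rightarrow> 'e) \<Rightarrow> bool" where
  "seminorm_continuous_on A N N' F \<longleftrightarrow>
     (\<forall>u\<in>A. \<forall>\<epsilon>>0. \<exists>\<delta>>0. \<forall>v\<in>A. N (v - u) < \<delta> \<longrightarrow> N' (F v - F u) < \<epsilon>)"

section \<open>Bochner--Lebesgue spaces\<close>

text \<open>Strong (Bochner) measurability; for a nonseparable target space this is more than Borel
  measurability.\<close>

definition strongly_measurable :: "'s measure \<Rightarrow> ('s \<Rightarrow> 'a::real_normed_vector) \<Rightarrow> bool" where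
  "strongly_measurable M u \<longleftrightarrow>
     (\<exists>s :: nat \<Rightarrow> 's \<Rightarrow> 'a. (\<forall>n. simple_function M (s n)) \<and>
        (AE x in M. (\<lambda>n. s n x) \<longlonglongrightarrow> u x))"

definition Lp :: "real \<Rightarrow> real \<Rightarrow> real \<Rightarrow> (real \<Rightarrow> 'a::banach) set" where
  "Lp p a b = {u. strongly_measurable (lebesgue_on {a<..<b}) u \<and>
                  integrable (lebesgue_on {a<..<b}) (\<lambda>t. norm (u t) powr p)}"

definition Lp_norm :: "real \<Rightarrow> real \<Rightarrow> real \<Rightarrow> (real \<Rightarrow> 'a::banach) \<Rightarrow> real" where
  "Lp_norm p a b u = (LINT t|lebesgue_on {a<..<b}. norm (u t) powr p) powr (1 / p)"

definition Lp_loc :: "real \<Rightarrow> (real \<Rightarrow> 'a::banach) set" where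
  "Lp_loc p = {u. \<forall>a b. u \<in> Lp p a b}"

section \<open>Stepanov spaces\<close>

text \<open>\<open>bochner_transform u t\<close> stands for an element of \<open>L\<^sup>p(0,1)\<close>; its values outside \<open>(0,1)\<close>
  are irrelevant.\<close>

definition bochner_transform :: "(real \<Rightarrow> 'a) \<Rightarrow> real \<Rightarrow> (real \<Rightarrow> 'a)" where
  "bochner_transform u t = (\<lambda>\<theta>. u (t + \<theta>))"

definition BSp :: "real \<Rightarrow> (real \<Rightarrow> 'a::banach) set" where
  "BSp p = {u \<in> Lp_loc p. bochner_transform u \<in> BC (Lp p 0 1) (Lp_norm p 0 1)}"

definition Sp_norm :: "real \<Rightarrow> (real \<Rightarrow> 'a::banach) \<Rightarrow> real" where
  "Sp_norm p u = (SUP t. Lp_norm p 0 1 (bochner_transform u t))"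

definition Spaa :: "real \<Rightarrow> (real \<Rightarrow> 'a::banach) set" where
  "Spaa p = {u \<in> Lp_loc p. bochner_transform u \<in> AA (Lp p 0 1) (Lp_norm p 0 1)}"

definition Lp_periodic :: "real \<Rightarrow> (real \<Rightarrow> 'a::banach) set" where
  "Lp_periodic p = {u \<in> Lp_loc p. AE t in lebesgue. u (t + 1) = u t}"

definition nemytskii :: "(real \<times> 'a \<Rightarrow> 'b) \<Rightarrow> (real \<Rightarrow> 'a) \<Rightarrow> (real \<Rightarrow> 'b)" where
  "nemytskii f u = (\<lambda>t. f (t, u t))"

end

theory Submission
  imports Defs "HOL-Library.Diagonal_Subsequence"
begin

text \<open>
  Translations are continuous in \<open>L\<^sup>p\<close>, so a function \<open>u\<close> is Stepanov almost automorphic if and only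
  if the sequence of its unit pieces \<open>u\<^sub>n = u(n + \<cdot>) \<in> L\<^sup>p(0,1)\<close> is almost automorphic over the integers: a
  real shift is an integer shift followed by a shift in \<open>[0,1]\<close>, and the latter converge along a
  subsequence by compactness.

  The \<open>n\<close>-th piece of the superposition \<open>t \<mapsto> f(t, u(t))\<close> is \<open>F n (u\<^sub>n)\<close> with \<open>F n w = f(n + \<cdot>, w)\<close>.
  Applied to periodic extensions of \<open>w \<in> L\<^sup>p(0,1)\<close>, continuity on \<open>L\<^sup>p\<^sub>1\<close> makes the maps \<open>F n\<close>
  equicontinuous at every \<open>w\<close>. By hypothesis \<open>n \<mapsto> F n x\<close> is almost automorphic for constants \<open>x\<close>; so
  is \<open>n \<mapsto> F n s\<close> for simple \<open>s\<close>, since integer shifts do not move the level sets of \<open>s\<close>, and then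
  \<open>n \<mapsto> F n w\<close> for all \<open>w\<close> by density and completeness. If the shifts of \<open>(u\<^sub>n)\<close> converge to \<open>(v\<^sub>n)\<close>,
  a diagonal argument over the countable set of all \<open>u\<^sub>n\<close> and \<open>v\<^sub>n\<close>, together with equicontinuity, shows
  that \<open>n \<mapsto> F n (u\<^sub>n)\<close> is almost automorphic. Continuity at \<open>u\<close> follows from equicontinuity because the
  pieces of \<open>u\<close> form a relatively compact set.
\<close>

section \<open>Bochner--Lebesgue spaces over a complete measure\<close>

text \<open>Stated over an arbitrary measure so that restrictions and measure-preserving maps can be
  treated abstractly; \<open>Lp p a b\<close> is the case
  \<open>lebesgue_on {a<..<b}\<close>.\<close>

definition Lp_on :: "'s measure \<Rightarrow> real \<Rightarrow> ('s \<Rightarrow> 'a::banach) set" where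
  "Lp_on M p = {u. strongly_measurable M u \<and> integrable M (\<lambda>t. norm (u t) powr p)}"

definition Lp_seminorm :: "'s measure \<Rightarrow> real \<Rightarrow> ('s \<Rightarrow> 'a::banach) \<Rightarrow> real" where
  "Lp_seminorm M p u = (LINT t|M. norm (u t) powr p) powr (1 / p)"

section \<open>Strong measurability\<close>

lemma strongly_measurable_simple: "simple_function M u \<Longrightarrow> strongly_measurable M u"
  unfolding strongly_measurable_def by (intro exI[of _ "\<lambda>_. u"]) auto

lemma strongly_measurable_diff:
  assumes "strongly_measurable M u" "strongly_measurable M v"
  shows "strongly_measurable M (u - v)"
proof -
  obtain s t where s: "\<And>n. simple_function M (s n)" "AE x in M. (\<lambda>n. s n x) \<longlonglongrightarrow> u x"
    and t: "\<And>n. simple_function M (t n)" "AE x in M. (\<lambda>n. t n x) \<longlonglongrightarrow> v x"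
    using assms unfolding strongly_measurable_def by blast
  have "simple_function M (\<lambda>x. s n x - t n x)" for n
    using s(1) t(1) by (rule simple_function_diff)
  moreover have "AE x in M. (\<lambda>n. s n x - t n x) \<longlonglongrightarrow> (u - v) x"
    using s(2) t(2) by eventually_elim (auto intro: tendsto_diff)
  ultimately show ?thesis
    unfolding strongly_measurable_def by (intro exI[of _ "\<lambda>n x. s n x - t n x"]) auto
qed

lemma strongly_measurable_cong:
  assumes "strongly_measurable M u" "AE x in M. u x = v x"
  shows "strongly_measurable M v"
proof -
  obtain s where s: "\<And>n. simple_function M (s n)" "AE x in M. (\<lambda>n. s n x) \<longlonglongrightarrow> u x"
    using assms unfolding strongly_measurable_def by blast
  have "AE x in M. (\<lambda>n. s n x) \<longlonglongrightarrow> v x"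
    using s(2) assms(2) by eventually_elim auto
  then show ?thesis
    using s(1) unfolding strongly_measurable_def by blast
qed

text \<open>The two preimages of a Borel set differ by a subset of a null set, which is measurable
  by completeness. Strong measurability fixes a function only up to such sets.\<close>

lemma borel_measurable_AE_eq:
  fixes g :: "'s \<Rightarrow> real"
  assumes "complete_measure M" "g \<in> borel_measurable M" "AE x in M. g x = h x"
  shows "h \<in> borel_measurable M"
proof (rule measurableI)
  fix A :: "real set" assume A: "A \<in> sets borel"
  interpret complete_measure M by fact
  show "h -` A \<inter> space M \<in> sets M"
  proof (rule in_sets_AE[of "g -` A \<inter> space M"])
    show "AE x in M. (x \<in> g -` A \<inter> space M) = (x \<in> h -` A \<inter> space M)"
      using assms(3) by eventually_elim auto
  qed (use assms(2) A in auto)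
qed auto

text \<open>The pointwise \<open>lim\<close> of the norms of the approximating simple functions is
  Borel measurable everywhere and agrees a.e. with \<open>norm (u x)\<close>; completeness transfers
  measurability.\<close>

lemma strongly_measurable_norm:
  assumes M: "complete_measure M" and u: "strongly_measurable M u"
  shows "(\<lambda>x. norm (u x)) \<in> borel_measurable M"
proof -
  obtain s where s: "\<And>n. simple_function M (s n)" "AE x in M. (\<lambda>n. s n x) \<longlonglongrightarrow> u x"
    using u unfolding strongly_measurable_def by blast
  have [measurable]: "(\<lambda>x. norm (s n x)) \<in> borel_measurable M" for n
    using simple_function_compose1[OF s(1)] by (rule borel_measurable_simple_function)
  have "(\<lambda>x. lim (\<lambda>n. norm (s n x))) \<in> borel_measurable M"
    by measurable
  moreover have "AE x in M. lim (\<lambda>n. norm (s n x)) = norm (u x)"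
    using s(2) by eventually_elim (auto intro!: limI tendsto_norm)
  ultimately show ?thesis
    by (rule borel_measurable_AE_eq[OF M])
qed

lemma Lp_onD:
  assumes "u \<in> Lp_on M p"
  shows "strongly_measurable M u" "integrable M (\<lambda>t. norm (u t) powr p)"
  using assms by (auto simp: Lp_on_def)

lemma Lp_on_bound:
  assumes M: "complete_measure M" and p: "0 < p" and u: "strongly_measurable M u"
    and g: "integrable M g" and le: "AE x in M. norm (u x) powr p \<le> g x"
  shows "u \<in> Lp_on M p"
proof -
  have [measurable]: "(\<lambda>x. norm (u x)) \<in> borel_measurable M"
    by (rule strongly_measurable_norm[OF M u])
  have "integrable M (\<lambda>t. norm (u t) powr p)"
  proof (rule Bochner_Integration.integrable_bound[OF g])
    show "AE x in M. norm (norm (u x) powr p) \<le> norm (g x)"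
      using le by eventually_elim auto
  qed measurable
  then show ?thesis using u by (simp add: Lp_on_def)
qed

section \<open>The p-seminorm and Minkowski's inequality\<close>

lemma Lp_seminorm_nonneg [simp]: "0 \<le> Lp_seminorm M p u"
  by (simp add: Lp_seminorm_def)

lemma Lp_seminorm_powr:
  assumes "0 < p"
  shows "Lp_seminorm M p u powr p = (LINT t|M. norm (u t) powr p)"
proof -
  have "0 \<le> (LINT t|M. norm (u t) powr p)" by (intro Bochner_Integration.integral_nonneg) auto
  then show ?thesis using assms by (simp add: Lp_seminorm_def powr_powr)
qed

lemma nn_integral_Lp:
  assumes "0 < p" "u \<in> Lp_on M p"
  shows "(\<integral>\<^sup>+ t. ennreal (norm (u t) powr p) \<partial>M) = ennreal (Lp_seminorm M p u powr p)"
  using assms by (simp add: Lp_seminorm_powr nn_integral_eq_integral Lp_onD)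

lemma powr_le_cancel:
  fixes x y p :: real
  assumes "0 < p" "0 \<le> x" "0 \<le> y" "x powr p \<le> y powr p"
  shows "x \<le> y"
  using powr_less_mono2[of p y x] assms by linarith

lemma Lp_seminorm_leI:
  assumes "0 < p" "0 \<le> c" "(LINT t|M. norm (u t) powr p) \<le> c powr p"
  shows "Lp_seminorm M p u \<le> c"
  by (rule powr_le_cancel[of p]) (use assms in \<open>auto simp: Lp_seminorm_powr\<close>)

lemma Lp_seminorm_mono:
  assumes p: "0 < p" and "u \<in> Lp_on M p" "v \<in> Lp_on M p" "AE x in M. norm (u x) \<le> norm (v x)"
  shows "Lp_seminorm M p u \<le> Lp_seminorm M p v"
proof -
  have "AE x in M. norm (u x) powr p \<le> norm (v x) powr p"
    using assms(4) by eventually_elim (use p in \<open>auto intro: powr_mono2\<close>)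
  then have "(LINT t|M. norm (u t) powr p) \<le> (LINT t|M. norm (v t) powr p)"
    using assms by (intro integral_mono_AE) (auto simp: Lp_onD)
  then show ?thesis
    unfolding Lp_seminorm_def using p by (intro powr_mono2) (auto intro: Bochner_Integration.integral_nonneg)
qed

text \<open>
  Minkowski's inequality comes from integrating this with \<open>x\<close>, \<open>y\<close> the pointwise norms of two functions
  and \<open>a\<close>, \<open>b\<close> slightly above their seminorms, which avoids a case distinction for seminorm \<open>0\<close>.
\<close>

lemma powr_add_le:
  fixes x y a b p :: real
  assumes "1 \<le> p" "0 \<le> x" "0 \<le> y" "0 < a" "0 < b"
  shows "(x + y) powr p \<le> (a + b) powr p * (a / (a + b) * (x / a) powr p + b / (a + b) * (y / b) powr p)"
proof -
  \<comment> \<open>This is convexity of the power function on the closed half-line. The end point 0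
    is treated separately: there the claim comes down to \<open>s powr p \<le> s\<close> for
    \<open>0 < s < 1\<close>.\<close>
  have *: "((1 - t) * X + t * Y) powr p \<le> (1 - t) * X powr p + t * Y powr p"
    if "0 \<le> X" "0 \<le> Y" "0 < t" "t < 1" for X Y t :: real
  proof (cases "X = 0 \<or> Y = 0")
    case True
    have "s powr p \<le> s" if "0 < s" "s < 1" for s :: real
      using powr_mono'[of 1 p s] that assms(1) by simp
    then show ?thesis using True that
      by (auto simp: powr_mult intro!: mult_right_mono)
  next
    case False
    then show ?thesis
      using convex_onD[OF powr_convex[OF assms(1)], of t X Y] that by auto
  qed
  \<comment> \<open>Up to the factor \<open>a + b\<close>, the sum is a convex combination of
    \<open>x / a\<close> and \<open>y / b\<close>.\<close>
  have eq: "(x + y) = (a + b) * ((1 - b / (a + b)) * (x / a) + b / (a + b) * (y / b))"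
  proof -
    have "1 - b / (a + b) = a / (a + b)" using assms by (simp add: field_simps)
    then show ?thesis using assms by (simp add: distrib_left)
  qed
  have "(x + y) powr p = (a + b) powr p * ((1 - b / (a + b)) * (x / a) + b / (a + b) * (y / b)) powr p"
    by (subst eq, subst powr_mult) (use assms in \<open>auto simp: field_simps\<close>)
  also have "\<dots> \<le> (a + b) powr p * ((1 - b / (a + b)) * (x / a) powr p + b / (a + b) * (y / b) powr p)"
    by (intro mult_left_mono *) (use assms in auto)
  also have "1 - b / (a + b) = a / (a + b)" using assms by (simp add: field_simps)
  finally show ?thesis .
qed

text \<open>Minkowski's inequality is phrased for differences because every distance below is the
  seminorm of a difference; a sum is obtained by subtracting a negative.\<close>

lemma Lp_on_diff:
  assumes M: "complete_measure M" and p: "1 \<le> p" and u: "u \<in> Lp_on M p" and v: "v \<in> Lp_on M p"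
  shows "u - v \<in> Lp_on M p" and "Lp_seminorm M p (u - v) \<le> Lp_seminorm M p u + Lp_seminorm M p v"
proof -
  define g where "g a b x = (a + b) powr p * (a / (a + b) * (norm (u x) / a) powr p + b / (a + b) * (norm (v x) / b) powr p)"
    for a b x
  have g': "g a b x = (a + b) powr p * (a / (a + b) / a powr p * norm (u x) powr p + b / (a + b) / b powr p * norm (v x) powr p)"
    if "0 < a" "0 < b" for a b x
    using that by (simp add: g_def powr_divide)
  have le: "norm ((u - v) x) powr p \<le> g a b x" if "0 < a" "0 < b" for a b x
  proof -
    have "norm ((u - v) x) powr p \<le> (norm (u x) + norm (v x)) powr p"
      using p by (intro powr_mono2) (auto intro: norm_triangle_ineq4)
    also have "\<dots> \<le> g a b x"
      unfolding g_def using p that by (intro powr_add_le) auto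
    finally show ?thesis .
  qed
  have int: "integrable M (g a b)" if "0 < a" "0 < b" for a b
    using u v unfolding g'[OF that, abs_def] by (auto intro!: integrable_mult_right Bochner_Integration.integrable_add Lp_onD)
  show mem: "u - v \<in> Lp_on M p"
    using p int[of 1 1] le[of 1 1] u v
    by (intro Lp_on_bound[OF M, of p _ "g 1 1"] strongly_measurable_diff Lp_onD(1)[OF u] Lp_onD(1)[OF v]) auto
  have "Lp_seminorm M p (u - v) \<le> (Lp_seminorm M p u + e) + (Lp_seminorm M p v + e)" if e: "e > 0" for e
  proof (rule Lp_seminorm_leI)
    \<comment> \<open>With these values the two normalized integrals are at most 1, so the convex
      combination in the majorant is at most 1 as well.\<close>
    define a b where "a = Lp_seminorm M p u + e" and "b = Lp_seminorm M p v + e"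
    have ab: "0 < a" "0 < b" using e by (auto simp: a_def b_def add_nonneg_pos)
    have "(LINT t|M. norm ((u - v) t) powr p) \<le> (LINT t|M. g a b t)"
      by (intro integral_mono Lp_onD(2)[OF mem] int[OF ab] le[OF ab])
    also have "\<dots> = (a + b) powr p * (a / (a + b) * ((LINT t|M. norm (u t) powr p) / a powr p)
        + b / (a + b) * ((LINT t|M. norm (v t) powr p) / b powr p))"
      using u v unfolding g'[OF ab] by (subst integral_mult_right_zero, subst Bochner_Integration.integral_add)
        (auto intro!: integrable_mult_right Lp_onD)
    also have "\<dots> \<le> (a + b) powr p * (a / (a + b) * 1 + b / (a + b) * 1)"
    proof (intro mult_left_mono add_mono)
      show "(LINT t|M. norm (u t) powr p) / a powr p \<le> 1" "(LINT t|M. norm (v t) powr p) / b powr p \<le> 1"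
        using ab p e unfolding a_def b_def
        by (auto simp: Lp_seminorm_powr[symmetric] intro!: powr_mono2)
    qed (use ab in auto)
    also have "\<dots> = (a + b) powr p" using ab by (simp add: add_divide_distrib[symmetric])
    finally show "(LINT t|M. norm ((u - v) t) powr p) \<le> (Lp_seminorm M p u + e + (Lp_seminorm M p v + e)) powr p"
      by (simp add: a_def b_def)
  qed (use p e in auto)
  note * = this
  show "Lp_seminorm M p (u - v) \<le> Lp_seminorm M p u + Lp_seminorm M p v"
  proof (rule field_le_epsilon)
    fix e :: real assume "e > 0"
    then show "Lp_seminorm M p (u - v) \<le> Lp_seminorm M p u + Lp_seminorm M p v + e"
      using *[of "e / 2"] by simp
  qed
qed

lemma Lp_seminorm_zero [simp]: "0 < p \<Longrightarrow> Lp_seminorm M p (\<lambda>_. 0) = 0"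
  by (simp add: Lp_seminorm_def)

lemma zero_in_Lp_on [simp]: "(\<lambda>_. 0) \<in> Lp_on M p"
  by (auto simp: Lp_on_def intro: strongly_measurable_simple)

lemma Lp_seminorm_commute: "Lp_seminorm M p (u - v) = Lp_seminorm M p (v - u)"
  by (simp add: Lp_seminorm_def norm_minus_commute)

lemma Lp_seminorm_triangle:
  assumes "complete_measure M" "1 \<le> p" "u \<in> Lp_on M p" "v \<in> Lp_on M p" "w \<in> Lp_on M p"
  shows "Lp_seminorm M p (u - w) \<le> Lp_seminorm M p (u - v) + Lp_seminorm M p (v - w)"
proof -
  have "u - w = (u - v) - (w - v)" by (auto simp: fun_eq_iff)
  then show ?thesis
    using Lp_on_diff(2)[OF assms(1,2) Lp_on_diff(1)[OF assms(1,2,3,4)] Lp_on_diff(1)[OF assms(1,2,5,4)]]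
    by (simp add: Lp_seminorm_commute[of _ _ w v])
qed

lemma Lp_on_cong:
  assumes "complete_measure M" "0 < p" "u \<in> Lp_on M p" "AE x in M. u x = v x"
  shows "v \<in> Lp_on M p"
proof (rule Lp_on_bound[OF assms(1,2)])
  show "strongly_measurable M v" using assms by (blast intro: strongly_measurable_cong Lp_onD)
  show "integrable M (\<lambda>t. norm (u t) powr p)" using assms by (simp add: Lp_onD)
qed (use assms(4) in eventually_elim, auto)

lemma Lp_seminorm_cong:
  assumes "complete_measure M" "0 < p" "u \<in> Lp_on M p" "AE x in M. u x = v x"
  shows "Lp_seminorm M p u = Lp_seminorm M p v"
proof -
  have "v \<in> Lp_on M p" by (rule Lp_on_cong[OF assms])
  then show ?thesis
    using assms by (intro antisym Lp_seminorm_mono) auto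
qed

section \<open>Density of simple functions and completeness\<close>

lemma Lp_on_simple_approx:
  assumes M: "complete_measure M" and p: "1 \<le> p" and u: "u \<in> Lp_on M p" and e: "e > 0"
  obtains s where "simple_function M s" "s \<in> Lp_on M p" "Lp_seminorm M p (s - u) < e"
proof -
  obtain s where s: "\<And>n. simple_function M (s n)" "AE x in M. (\<lambda>n. s n x) \<longlonglongrightarrow> u x"
    using Lp_onD(1)[OF u] unfolding strongly_measurable_def by blast
  have [measurable]: "(\<lambda>x. norm (u x)) \<in> borel_measurable M"
    by (rule strongly_measurable_norm[OF M Lp_onD(1)[OF u]])
  have [measurable]: "(\<lambda>x. norm (s n x)) \<in> borel_measurable M" for n
    using simple_function_compose1[OF s(1)] by (rule borel_measurable_simple_function)
  \<comment> \<open>The approximants converge only a.e., so they are cut off to obtain the majorant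
    \<open>3 * norm (u x)\<close> for \<open>t n x - u x\<close> and to apply dominated convergence.
    As 2 exceeds 1, the cut-off is eventually inactive where \<open>u x\<close> is nonzero; where
    \<open>u x = 0\<close> it yields 0.\<close>
  define t where "t n x = (if norm (s n x) \<le> 2 * norm (u x) then s n x else 0)" for n x
  have t: "simple_function M (t n)" for n
    unfolding t_def using s(1) by (intro simple_function_If) auto
  have tn: "norm (t n x) \<le> 2 * norm (u x)" for n x by (simp add: t_def)
  have lim: "AE x in M. (\<lambda>n. t n x) \<longlonglongrightarrow> u x"
    using s(2)
  proof eventually_elim
    case (elim x)
    show ?case
    proof (cases "u x = 0")
      case True
      then have "t n x = 0" for n by (auto simp: t_def)
      then show ?thesis using True by simp
    next
      case False
      have "(\<lambda>n. norm (s n x)) \<longlonglongrightarrow> norm (u x)" using elim by (rule tendsto_norm)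
      then have "\<forall>\<^sub>F n in sequentially. norm (s n x) < 2 * norm (u x)"
        by (rule order_tendstoD) (use False in auto)
      then have "\<forall>\<^sub>F n in sequentially. t n x = s n x"
        by eventually_elim (auto simp: t_def)
      then show ?thesis using elim by (simp add: tendsto_cong)
    qed
  qed
  have int: "integrable M (\<lambda>x. 3 powr p * norm (u x) powr p)" using u by (auto intro: Lp_onD)
  have tL: "t n \<in> Lp_on M p" for n
  proof (rule Lp_on_bound[OF M _ strongly_measurable_simple[OF t] int])
    have "norm (t n x) powr p \<le> 3 powr p * norm (u x) powr p" for x
      unfolding powr_mult[symmetric] using tn[of n x] p by (intro powr_mono2) (auto intro: order_trans)
    then show "AE x in M. norm (t n x) powr p \<le> 3 powr p * norm (u x) powr p" by simp
  qed (use p in auto)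
  have "(\<lambda>n. LINT x|M. norm ((t n - u) x) powr p) \<longlonglongrightarrow> (LINT x|M. 0)"
  proof (rule integral_dominated_convergence[where w="\<lambda>x. 3 powr p * norm (u x) powr p"])
    show "AE x in M. (\<lambda>n. norm ((t n - u) x) powr p) \<longlonglongrightarrow> 0"
      using lim
    proof eventually_elim
      case (elim x)
      then have "(\<lambda>n. norm (t n x - u x)) \<longlonglongrightarrow> 0"
        by (simp add: LIM_zero tendsto_norm_zero)
      then have "(\<lambda>n. norm (t n x - u x) powr p) \<longlonglongrightarrow> 0 powr p"
        using p by (intro tendsto_powr2) auto
      then show ?case using p by simp
    qed
    show "AE x in M. norm (norm ((t n - u) x) powr p) \<le> 3 powr p * norm (u x) powr p" for n
    proof (intro AE_I2)
      fix x
      have "norm (t n x - u x) \<le> 3 * norm (u x)"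
        using norm_triangle_ineq4[of "t n x" "u x"] tn[of n x] by linarith
      then have "norm (t n x - u x) powr p \<le> (3 * norm (u x)) powr p"
        using p by (intro powr_mono2) auto
      then show "norm (norm ((t n - u) x) powr p) \<le> 3 powr p * norm (u x) powr p"
        by (simp add: powr_mult)
    qed
    show "(\<lambda>x. norm ((t n - u) x) powr p) \<in> borel_measurable M" for n
      using Lp_onD(2)[OF Lp_on_diff(1)[OF M p tL u]] by (rule borel_measurable_integrable)
  qed (use int in auto)
  then have "(\<lambda>n. Lp_seminorm M p (t n - u)) \<longlonglongrightarrow> 0 powr (1 / p)"
    unfolding Lp_seminorm_def using p by (intro tendsto_powr2) (auto intro: Bochner_Integration.integral_nonneg)
  then have "\<forall>\<^sub>F n in sequentially. Lp_seminorm M p (t n - u) < e"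
    using e p by (intro order_tendstoD(2)) auto
  then obtain n where "Lp_seminorm M p (t n - u) < e"
    by (auto simp: eventually_sequentially)
  then show thesis using that t tL by blast
qed

text \<open>Riesz-Fischer: simple functions close to terms of the sequence, with geometrically small
  gaps, converge a.e.; Fatou's lemma turns the gaps into seminorm bounds for the limit, and the
  Cauchy condition extends convergence to all of \<open>u\<close>.\<close>

lemma Lp_on_complete:
  assumes M: "complete_measure M" and p: "1 \<le> p" and u: "\<And>n. u n \<in> Lp_on M p"
    and Cauchy: "\<And>e. e > 0 \<Longrightarrow> \<exists>N. \<forall>m\<ge>N. \<forall>n\<ge>N. Lp_seminorm M p (u m - u n) < e"
  obtains v where "v \<in> Lp_on M p" "(\<lambda>n. Lp_seminorm M p (u n - v)) \<longlonglongrightarrow> 0"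
proof -
  let ?N = "Lp_seminorm M p"
  \<comment> \<open>Replacing a fast subsequence of \<open>u\<close> by simple functions makes the strong measurability of the
    a.e. limit immediate.\<close>
  define c :: "nat \<Rightarrow> real" where "c k = (1/4) ^ k / 4" for k
  have c: "c k > 0" for k by (simp add: c_def)
  have cmono: "c m \<le> c k" if "k \<le> m" for k m
    using that by (simp add: c_def power_decreasing)
  have "\<forall>k. \<exists>r. \<forall>m\<ge>r. \<forall>n\<ge>r. ?N (u m - u n) < c k" using Cauchy c by blast
  then obtain r where r: "\<And>k m n. m \<ge> r k \<Longrightarrow> n \<ge> r k \<Longrightarrow> ?N (u m - u n) < c k" by metis
  have "\<forall>k. \<exists>s. simple_function M s \<and> s \<in> Lp_on M p \<and> ?N (s - u (r k)) < c k"
    using Lp_on_simple_approx[OF M p u c] by metis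
  then obtain s where s: "\<And>k. simple_function M (s k)" "\<And>k. s k \<in> Lp_on M p" "\<And>k. ?N (s k - u (r k)) < c k"
    by metis
  have su: "?N (s k - u m) < 2 * c k" if "m \<ge> r k" for k m
    using Lp_seminorm_triangle[OF M p s(2)[of k] u[of "r k"] u[of m]] r[of k "r k" m] s(3)[of k] that by simp
  have ss: "?N (s m - s k) \<le> 4 * c k" if "k \<le> m" for k m
  proof -
    \<comment> \<open>This index lies past both thresholds, so \<open>s m\<close> and
      \<open>s k\<close> can be compared through the single term \<open>u j\<close>.\<close>
    define j where "j = r k + r m"
    have "?N (s m - s k) \<le> ?N (s m - u j) + ?N (s k - u j)"
      using Lp_seminorm_triangle[OF M p s(2)[of m] u[of j] s(2)[of k]]
      by (simp add: Lp_seminorm_commute[of _ _ "s k"])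
    also have "\<dots> \<le> 2 * c m + 2 * c k"
      using su[of m j] su[of k j] by (simp add: j_def)
    also have "\<dots> \<le> 4 * c k" using cmono[OF that] by simp
    finally show ?thesis .
  qed
  have dL: "s m - s k \<in> Lp_on M p" for m k by (intro Lp_on_diff(1) M p s)
  have [measurable]: "(\<lambda>x. norm (s m x - s k x)) \<in> borel_measurable M" for m k
    using simple_function_compose2[OF s(1) s(1), of "\<lambda>a b. norm (a - b)"] by (rule borel_measurable_simple_function)
  \<comment> \<open>The weight \<open>2 ^ k\<close> leaves \<open>(1/2) ^ k\<close> of the gap
    \<open>4 * c k = (1/4) ^ k\<close>. Hence the weighted powers are summable a.e., and their terms
    drop below 1, which forces the increments of \<open>s\<close> below \<open>(1/2) ^ k\<close>
    eventually.\<close>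
  have bd: "(\<integral>\<^sup>+x. ennreal ((2 ^ k * norm (s (Suc k) x - s k x)) powr p) \<partial>M) \<le> ennreal ((1/2) ^ k)" for k
  proof -
    have "(\<integral>\<^sup>+x. ennreal ((2 ^ k * norm (s (Suc k) x - s k x)) powr p) \<partial>M)
        = ennreal ((2 ^ k) powr p) * (\<integral>\<^sup>+x. ennreal (norm ((s (Suc k) - s k) x) powr p) \<partial>M)"
      by (subst nn_integral_cmult[symmetric]) (auto simp: powr_mult ennreal_mult intro!: nn_integral_cong)
    also have "\<dots> = ennreal ((2 ^ k * ?N (s (Suc k) - s k)) powr p)"
      using p dL by (subst nn_integral_Lp) (auto simp: powr_mult ennreal_mult)
    also have "\<dots> \<le> ennreal ((2 ^ k * (4 * c k)) powr p)"
      using p ss[of k "Suc k"] by (intro ennreal_leI powr_mono2 mult_left_mono) auto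
    also have "2 ^ k * (4 * c k) = (1/2) ^ k" by (simp add: c_def power_divide power_mult_distrib[symmetric] field_simps)
    also have "((1/2::real) ^ k) powr p \<le> (1/2) ^ k"
      using powr_mono'[of 1 p "(1/2::real)^k"] p by (simp add: power_le_one)
    finally show ?thesis by (simp add: ennreal_leI)
  qed
  have "(\<integral>\<^sup>+x. (\<Sum>k. ennreal ((2 ^ k * norm (s (Suc k) x - s k x)) powr p)) \<partial>M)
     = (\<Sum>k. \<integral>\<^sup>+x. ennreal ((2 ^ k * norm (s (Suc k) x - s k x)) powr p) \<partial>M)"
    by (intro nn_integral_suminf) measurable
  also have "\<dots> \<le> (\<Sum>k. ennreal ((1/2) ^ k))"
    by (intro suminf_le bd) auto
  also have "\<dots> < \<infinity>"
    by (subst suminf_ennreal2) (auto simp: summable_geometric)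
  finally have "AE x in M. (\<Sum>k. ennreal ((2 ^ k * norm (s (Suc k) x - s k x)) powr p)) \<noteq> \<infinity>"
    by (intro nn_integral_PInf_AE) auto
  then have conv: "AE x in M. convergent (\<lambda>k. s k x)"
  proof eventually_elim
    case (elim x)
    then have "summable (\<lambda>k. (2 ^ k * norm (s (Suc k) x - s k x)) powr p)"
      by (intro summable_suminf_not_top) (auto simp: top_ennreal_def)
    then have "(\<lambda>k. (2 ^ k * norm (s (Suc k) x - s k x)) powr p) \<longlonglongrightarrow> 0"
      by (rule summable_LIMSEQ_zero)
    then have "\<forall>\<^sub>F k in sequentially. (2 ^ k * norm (s (Suc k) x - s k x)) powr p < 1"
      by (rule order_tendstoD) auto
    then have "\<forall>\<^sub>F k in sequentially. norm (s (Suc k) x - s k x) \<le> (1/2) ^ k"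
    proof eventually_elim
      case (elim k)
      have "2 ^ k * norm (s (Suc k) x - s k x) < 1"
      proof (rule ccontr)
        assume "\<not> ?thesis"
        then have "1 powr p \<le> (2 ^ k * norm (s (Suc k) x - s k x)) powr p"
          using p by (intro powr_mono2) auto
        then show False using elim by simp
      qed
      then show ?case by (simp add: field_simps power_divide)
    qed
    then have "summable (\<lambda>k. s (Suc k) x - s k x)"
      by (rule summable_comparison_test_ev) (auto simp: summable_geometric)
    then have "convergent (\<lambda>n. \<Sum>k<n. s (Suc k) x - s k x)"
      by (simp add: summable_iff_convergent)
    then have "convergent (\<lambda>n. (s n x - s 0 x) + s 0 x)"
      by (subst (asm) sum_lessThan_telescope) (intro convergent_add convergent_const)
    then show ?case by simp
  qed
  define v where "v x = lim (\<lambda>k. s k x)" for x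
  have sv: "AE x in M. (\<lambda>k. s k x) \<longlonglongrightarrow> v x"
    using conv by eventually_elim (auto simp: v_def convergent_LIMSEQ_iff)
  have v: "strongly_measurable M v"
    using s(1) sv unfolding strongly_measurable_def by blast
  \<comment> \<open>Fatou's lemma is applied to \<open>s j - s k\<close> as \<open>j\<close> grows
    with \<open>k\<close> fixed, so the bound \<open>ss\<close> survives for the a.e. limit.\<close>
  have vs: "v - s k \<in> Lp_on M p \<and> ?N (v - s k) \<le> 4 * c k" for k
  proof -
    have sm: "strongly_measurable M (v - s k)"
      by (intro strongly_measurable_diff v strongly_measurable_simple s)
    have [measurable]: "(\<lambda>x. norm ((v - s k) x)) \<in> borel_measurable M"
      by (rule strongly_measurable_norm[OF M sm])
    have "(\<integral>\<^sup>+x. ennreal (norm ((v - s k) x) powr p) \<partial>M)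
      = (\<integral>\<^sup>+x. liminf (\<lambda>j. ennreal (norm (s j x - s k x) powr p)) \<partial>M)"
    proof (rule nn_integral_cong_AE)
      show "AE x in M. ennreal (norm ((v - s k) x) powr p) = liminf (\<lambda>j. ennreal (norm (s j x - s k x) powr p))"
        using sv
      proof eventually_elim
        case (elim x)
        then have "(\<lambda>j. norm (s j x - s k x) powr p) \<longlonglongrightarrow> norm (v x - s k x) powr p"
          using p by (intro tendsto_powr2 tendsto_intros) auto
        then have "(\<lambda>j. ennreal (norm (s j x - s k x) powr p)) \<longlonglongrightarrow> ennreal (norm (v x - s k x) powr p)"
          by (rule tendsto_ennrealI)
        then have "liminf (\<lambda>j. ennreal (norm (s j x - s k x) powr p)) = ennreal (norm (v x - s k x) powr p)"
            by (intro lim_imp_Liminf) auto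
          then show ?case by simp
      qed
    qed
    also have "\<dots> \<le> liminf (\<lambda>j. \<integral>\<^sup>+x. ennreal (norm (s j x - s k x) powr p) \<partial>M)"
      by (rule nn_integral_liminf) measurable
    also have "\<dots> \<le> liminf (\<lambda>j. ennreal ((4 * c k) powr p))"
    proof (rule Liminf_mono)
      show "\<forall>\<^sub>F j in sequentially. (\<integral>\<^sup>+x. ennreal (norm (s j x - s k x) powr p) \<partial>M) \<le> ennreal ((4 * c k) powr p)"
        using eventually_ge_at_top[of k]
      proof eventually_elim
        case (elim j)
        have "(\<integral>\<^sup>+x. ennreal (norm (s j x - s k x) powr p) \<partial>M) = ennreal (?N (s j - s k) powr p)"
          using nn_integral_Lp[OF _ dL[of j k]] p by simp
        also have "\<dots> \<le> ennreal ((4 * c k) powr p)"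
          using p ss[OF elim] by (intro ennreal_leI powr_mono2) auto
        finally show ?case .
      qed
    qed
    also have "\<dots> = ennreal ((4 * c k) powr p)" by (simp add: Liminf_const)
    finally have le: "(\<integral>\<^sup>+x. ennreal (norm ((v - s k) x) powr p) \<partial>M) \<le> ennreal ((4 * c k) powr p)" .
    have "integrable M (\<lambda>x. norm ((v - s k) x) powr p)"
    proof (rule integrableI_bounded)
      show "(\<lambda>x. norm ((v - s k) x) powr p) \<in> borel_measurable M" by measurable
    qed (use le_less_trans[OF le ennreal_less_top] in simp)
    with sm have mem: "v - s k \<in> Lp_on M p" by (simp add: Lp_on_def)
    have "ennreal (?N (v - s k) powr p) \<le> ennreal ((4 * c k) powr p)"
      using le nn_integral_Lp[OF _ mem] p by simp
    then have "?N (v - s k) powr p \<le> (4 * c k) powr p" by (simp add: ennreal_le_iff)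
    then have "?N (v - s k) \<le> 4 * c k"
      by (rule powr_le_cancel[rotated 3]) (use p c[of k] in auto)
    with mem show ?thesis by blast
  qed
  have vL: "v \<in> Lp_on M p"
  proof -
    \<comment> \<open>The sum of \<open>v - s 0\<close> and \<open>s 0\<close> is written as a
      difference, for which closure is available.\<close>
    have "v = (v - s 0) - ((\<lambda>_. 0) - s 0)" by (auto simp: fun_eq_iff)
    then show ?thesis
      using Lp_on_diff(1)[OF M p conjunct1[OF vs[of 0]] Lp_on_diff(1)[OF M p zero_in_Lp_on s(2)[of 0]]] by simp
  qed
  have "(\<lambda>n. ?N (u n - v)) \<longlonglongrightarrow> 0"
  proof (rule LIMSEQ_I)
    fix e :: real assume e: "e > 0"
    have "(\<lambda>k. 6 * c k) \<longlonglongrightarrow> 6 * (0 / 4)"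
      unfolding c_def by (intro tendsto_intros LIMSEQ_power_zero) auto
    then have "\<forall>\<^sub>F k in sequentially. 6 * c k < e"
      using e by (intro order_tendstoD(2)) auto
    then obtain k where k: "6 * c k < e" by (auto simp: eventually_sequentially)
    have "norm (?N (u n - v) - 0) < e" if "n \<ge> r k" for n
      using Lp_seminorm_triangle[OF M p u[of n] s(2)[of k] vL] su[OF that] vs[of k] k
      by (simp add: Lp_seminorm_commute[of _ _ "s k"])
    then show "\<exists>no. \<forall>n\<ge>no. norm (?N (u n - v) - 0) < e" by blast
  qed
  with vL show thesis by (rule that)
qed

section \<open>Restriction, translation and gluing\<close>

lemma complete_measure_restrict_space:
  assumes M: "complete_measure M" and S: "S \<in> sets M"
  shows "complete_measure (restrict_space M S)"
proof
  fix A B assume "B \<subseteq> A" "A \<in> null_sets (restrict_space M S)"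
  moreover from S have "S \<inter> space M \<in> sets M" by simp
  ultimately have "A \<in> null_sets M" "A \<subseteq> S" "B \<subseteq> A" by (auto simp: null_sets_restrict_space S)
  then have "B \<in> sets M" "B \<subseteq> S"
    using complete_measure.complete[OF M, of B A] by auto
  with S show "B \<in> sets (restrict_space M S)"
    by (simp add: sets_restrict_space_iff)
qed

lemma complete_measure_lebesgue: "complete_measure lebesgue"
  by (rule completion.complete_measure_axioms)

lemma complete_measure_lebesgue_on [simp]: "S \<in> sets lebesgue \<Longrightarrow> complete_measure (lebesgue_on S)"
  by (intro complete_measure_restrict_space complete_measure_lebesgue)

section \<open>Restriction, change of variables and countable gluing\<close>

lemma strongly_measurable_restrict_space:
  assumes S: "S \<in> sets M" and u: "strongly_measurable M u"
  shows "strongly_measurable (restrict_space M S) u"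
proof -
  obtain s where s: "\<And>n. simple_function M (s n)" "AE x in M. (\<lambda>n. s n x) \<longlonglongrightarrow> u x"
    using u unfolding strongly_measurable_def by blast
  have "simple_function (restrict_space M S) (s n)" for n
    using s(1) S by (subst simple_function_restrict_space) (auto intro!: simple_function_compose2[where h="(*\<^sub>R)"])
  moreover have "AE x in restrict_space M S. (\<lambda>n. s n x) \<longlonglongrightarrow> u x"
    using s(2) S by (subst AE_restrict_space_iff) auto
  ultimately show ?thesis unfolding strongly_measurable_def by blast
qed

lemma strongly_measurable_extend:
  assumes S: "S \<in> sets M" and u: "strongly_measurable (restrict_space M S) u"
  shows "strongly_measurable M (\<lambda>x. indicator S x *\<^sub>R u x)"
proof -
  obtain s where s: "\<And>n. simple_function (restrict_space M S) (s n)"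
      "AE x in restrict_space M S. (\<lambda>n. s n x) \<longlonglongrightarrow> u x"
    using u unfolding strongly_measurable_def by blast
  have "simple_function M (\<lambda>x. indicator S x *\<^sub>R s n x)" for n
    using s(1) S by (subst simple_function_restrict_space[symmetric]) auto
  moreover have "AE x in M. x \<in> S \<longrightarrow> (\<lambda>n. s n x) \<longlonglongrightarrow> u x"
    using s(2) S by (subst (asm) AE_restrict_space_iff) auto
  then have "AE x in M. (\<lambda>n. indicator S x *\<^sub>R s n x) \<longlonglongrightarrow> indicator S x *\<^sub>R u x"
    by eventually_elim (auto split: split_indicator)
  ultimately show ?thesis
    unfolding strongly_measurable_def by (intro exI[of _ "\<lambda>n x. indicator S x *\<^sub>R s n x"]) auto
qed

lemma Lp_on_restrict_space:
  assumes S: "S \<in> sets M" and u: "u \<in> Lp_on M p" and p: "0 < p"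
  shows "u \<in> Lp_on (restrict_space M S) p"
    and "Lp_seminorm (restrict_space M S) p u \<le> Lp_seminorm M p u"
proof -
  have int: "integrable M (\<lambda>x. indicator S x *\<^sub>R norm (u x) powr p)"
    using S Lp_onD(2)[OF u] by (rule integrable_mult_indicator)
  then show "u \<in> Lp_on (restrict_space M S) p"
    using S u by (simp add: Lp_on_def strongly_measurable_restrict_space integrable_restrict_space)
  have "(LINT x|M. indicator S x *\<^sub>R norm (u x) powr p) \<le> (LINT x|M. norm (u x) powr p)"
    using int Lp_onD(2)[OF u] by (intro integral_mono) (auto split: split_indicator)
  also have "(LINT x|M. indicator S x *\<^sub>R norm (u x) powr p) = (LINT x|restrict_space M S. norm (u x) powr p)"
    using S by (subst integral_restrict_space) auto
  finally show "Lp_seminorm (restrict_space M S) p u \<le> Lp_seminorm M p u"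
    unfolding Lp_seminorm_def using p by (intro powr_mono2) auto
qed

text \<open>Composition with \<open>T\<close> keeps the approximants simple, and
  \<open>distr M N T = N\<close> says that \<open>T\<close> preserves the measure, so exceptional
  null sets pull back to null sets.\<close>

lemma strongly_measurable_distr:
  assumes T: "T \<in> measurable M N" "distr M N T = N" and u: "strongly_measurable N u"
  shows "strongly_measurable M (\<lambda>x. u (T x))"
proof -
  obtain s where s: "\<And>n. simple_function N (s n)" "AE x in N. (\<lambda>n. s n x) \<longlonglongrightarrow> u x"
    using u unfolding strongly_measurable_def by blast
  have "AE x in M. (\<lambda>n. s n (T x)) \<longlonglongrightarrow> u (T x)"
    using s(2) by (intro AE_distrD[OF T(1)]) (simp only: T(2))
  then show ?thesis
    unfolding strongly_measurable_def using simple_function_comp[OF T(1) s(1)]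
    by (intro exI[of _ "\<lambda>n x. s n (T x)"]) auto
qed

lemma Lp_on_distr:
  assumes T: "T \<in> measurable M N" "distr M N T = N" and u: "u \<in> Lp_on N p"
  shows "(\<lambda>x. u (T x)) \<in> Lp_on M p" and "Lp_seminorm M p (\<lambda>x. u (T x)) = Lp_seminorm N p u"
proof -
  have "integrable (distr M N T) (\<lambda>x. norm (u x) powr p)"
    using Lp_onD(2)[OF u] T by simp
  then have "integrable M (\<lambda>x. norm (u (T x)) powr p)"
    by (rule integrable_distr[OF T(1)])
  then show "(\<lambda>x. u (T x)) \<in> Lp_on M p"
    using strongly_measurable_distr[OF T Lp_onD(1)[OF u]] by (simp add: Lp_on_def)
  have "(LINT x|distr M N T. norm (u x) powr p) = (LINT x|M. norm (u (T x)) powr p)"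
    by (rule integral_distr[OF T(1) borel_measurable_integrable[OF Lp_onD(2)[OF u]]])
  then show "Lp_seminorm M p (\<lambda>x. u (T x)) = Lp_seminorm N p u"
    by (simp add: Lp_seminorm_def T(2))
qed

text \<open>The index \<open>h\<close> may take infinitely many values, so the \<open>n\<close>-th
  approximant uses only the pieces \<open>i < n\<close> and stays simple; at a given point it is the
  right one once \<open>n\<close> exceeds \<open>h x\<close>. Countably many pieces share one
  exceptional null set.\<close>

lemma strongly_measurable_glue:
  fixes h :: "'s \<Rightarrow> nat"
  assumes h: "h \<in> measurable M (count_space UNIV)" and g: "\<And>i. strongly_measurable M (g i)"
  shows "strongly_measurable M (\<lambda>x. g (h x) x)"
proof -
  have "\<forall>i. \<exists>s. (\<forall>n. simple_function M (s n)) \<and> (AE x in M. (\<lambda>n. s n x) \<longlonglongrightarrow> g i x)"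
    using g unfolding strongly_measurable_def by blast
  then obtain s where s: "\<And>i n. simple_function M (s i n)" "\<And>i. AE x in M. (\<lambda>n. s i n x) \<longlonglongrightarrow> g i x"
    by metis
  define t where "t n x = (\<Sum>i<n. if h x = i then s i n x else 0)" for n x
  have t: "t n x = s (h x) n x" if "h x < n" for n x
    using that unfolding t_def by (subst sum.delta') auto
  have hi: "{x \<in> space M. h x = i} \<in> sets M" for i
    using measurable_sets[OF h, of "{i}"] by (simp add: vimage_def Int_def conj_commute)
  have "simple_function M (t n)" for n
    unfolding t_def using s(1) hi by (intro simple_function_sum simple_function_If) auto
  moreover have "AE x in M. \<forall>i. (\<lambda>n. s i n x) \<longlonglongrightarrow> g i x"
    using s(2) by (simp add: AE_all_countable)
  then have "AE x in M. (\<lambda>n. t n x) \<longlonglongrightarrow> g (h x) x"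
  proof eventually_elim
    case (elim x)
    have "\<forall>\<^sub>F n in sequentially. s (h x) n x = t n x"
      using eventually_gt_at_top[of "h x"] by eventually_elim (simp add: t)
    then show ?case using elim by (blast intro: Lim_transform_eventually)
  qed
  ultimately show ?thesis unfolding strongly_measurable_def by blast
qed

section \<open>Intervals of the real line\<close>

lemma Lp_eq_Lp_on: "Lp p a b = Lp_on (lebesgue_on {a<..<b}) p"
  by (simp add: Lp_def Lp_on_def)

lemma Lp_norm_eq_Lp_seminorm: "Lp_norm p a b u = Lp_seminorm (lebesgue_on {a<..<b}) p u"
  by (simp add: Lp_norm_def Lp_seminorm_def)

lemma Lp_norm_nonneg [simp]: "0 \<le> Lp_norm p a b u"
  by (simp add: Lp_norm_eq_Lp_seminorm)

lemma Lp_subinterval: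
  assumes "u \<in> Lp p a b" "0 < p" "a \<le> a'" "b' \<le> b"
  shows "u \<in> Lp p a' b'" "Lp_norm p a' b' u \<le> Lp_norm p a b u"
proof -
  have "lebesgue_on {a'<..<b'} = restrict_space (lebesgue_on {a<..<b}) {a'<..<b'}"
    using assms(3,4) by (subst restrict_restrict_space) (auto intro!: arg_cong[of _ _ "restrict_space lebesgue"])
  moreover have "{a'<..<b'} \<in> sets (lebesgue_on {a<..<b})"
    using assms(3,4) by (subst sets_restrict_space_iff) auto
  ultimately show "u \<in> Lp p a' b'" "Lp_norm p a' b' u \<le> Lp_norm p a b u"
    using assms Lp_on_restrict_space[of "{a'<..<b'}" "lebesgue_on {a<..<b}" u p]
    by (auto simp: Lp_eq_Lp_on Lp_norm_eq_Lp_seminorm)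
qed

lemma distr_lebesgue_translation:
  fixes c :: real
  shows "(\<lambda>x. c + x) \<in> measurable (lebesgue_on {a<..<b}) (lebesgue_on {c + a<..<c + b})" (is "?T \<in> measurable ?M ?N")
    and "distr (lebesgue_on {a<..<b}) (lebesgue_on {c + a<..<c + b}) (\<lambda>x. c + x) = lebesgue_on {c + a<..<c + b}"
proof -
  have m: "?T \<in> measurable lebesgue lebesgue"
    using lebesgue_affine_measurable[of "\<lambda>_. 1" c] by simp
  have d: "distr lebesgue lebesgue ?T = lebesgue"
    using lebesgue_real_affine[of 1 c] by (simp add: density_1)
  show T: "?T \<in> measurable ?M ?N"
    using m by (intro measurable_restrict_space3) auto
  show "distr ?M ?N ?T = ?N"
  proof (rule measure_eqI)
    fix A assume "A \<in> sets (distr ?M ?N ?T)"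
    then have A: "A \<in> sets lebesgue" "A \<subseteq> {c + a<..<c + b}" "A \<in> sets ?N"
      by (auto simp: sets_restrict_space_iff)
    have "emeasure (distr ?M ?N ?T) A = emeasure ?M (?T -` A \<inter> space ?M)"
      using T A by (simp add: emeasure_distr)
    also have "?T -` A \<inter> space ?M = ?T -` A"
      using A(2) by (auto simp: space_restrict_space)
    also have "emeasure ?M (?T -` A) = emeasure lebesgue (?T -` A)"
      using A(2) by (subst emeasure_restrict_space) auto
    also have "\<dots> = emeasure (distr lebesgue lebesgue ?T) A"
      using A m by (simp add: emeasure_distr)
    also have "\<dots> = emeasure ?N A"
      using A d by (subst emeasure_restrict_space) auto
    finally show "emeasure (distr ?M ?N ?T) A = emeasure ?N A" .
  qed simp
qed

lemma Lp_translation: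
  assumes "u \<in> Lp p (c + a) (c + b)"
  shows "(\<lambda>x. u (c + x)) \<in> Lp p a b" and "Lp_norm p a b (\<lambda>x. u (c + x)) = Lp_norm p (c + a) (c + b) u"
  using Lp_on_distr[OF distr_lebesgue_translation assms[unfolded Lp_eq_Lp_on]]
  unfolding Lp_eq_Lp_on Lp_norm_eq_Lp_seminorm by blast+

text \<open>Agreement on the open interval suffices, so the values that gluing with
  \<open>floor\<close> assigns at integers do not interfere.\<close>

lemma Lp_cong:
  assumes "0 < p" "u \<in> Lp p a b" "\<And>x. a < x \<Longrightarrow> x < b \<Longrightarrow> u x = v x"
  shows "v \<in> Lp p a b"
proof -
  have "AE x in lebesgue_on {a<..<b}. u x = v x"
    using assms(3) by (intro AE_I2) (auto simp: space_restrict_space)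
  then show ?thesis
    using assms(1,2) unfolding Lp_eq_Lp_on by (intro Lp_on_cong[of _ p u v]) auto
qed

lemma Lp_norm_cong:
  assumes "\<And>x. a < x \<Longrightarrow> x < b \<Longrightarrow> u x = v x"
  shows "Lp_norm p a b u = Lp_norm p a b v"
  unfolding Lp_norm_def using assms
  by (intro arg_cong[of _ _ "\<lambda>x. x powr (1/p)"] Bochner_Integration.integral_cong) (auto simp: space_restrict_space)

text \<open>The integers form a null set, hence the open intervals between consecutive integers
  cover almost all of the line.\<close>

lemma AE_lebesgue_floor_neq: "AE t in lebesgue. t \<noteq> real_of_int \<lfloor>t\<rfloor>"
proof -
  have "(\<int> :: real set) \<in> null_sets lborel"
    by (intro countable_imp_null_set_lborel countable_int)
  then have "AE t in lebesgue. t \<notin> (\<int> :: real set)"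
    by (intro AE_not_in null_sets_completionI)
  then show ?thesis by eventually_elim (metis Ints_of_int)
qed

text \<open>Strong measurability on the line follows by gluing the countably many unit pieces;
  integrability on a bounded interval follows because it meets finitely many of them.\<close>

lemma Lp_loc_iff:
  fixes u :: "real \<Rightarrow> 'a::banach"
  assumes p: "1 \<le> p"
  shows "u \<in> Lp_loc p \<longleftrightarrow> (\<forall>n::int. (\<lambda>\<theta>. u (of_int n + \<theta>)) \<in> Lp p 0 1)"
proof
  assume "u \<in> Lp_loc p"
  then show "\<forall>n::int. (\<lambda>\<theta>. u (of_int n + \<theta>)) \<in> Lp p 0 1"
    unfolding Lp_loc_def using Lp_translation(1)[of u p _ 0 1] by simp
next
  assume U: "\<forall>n::int. (\<lambda>\<theta>. u (of_int n + \<theta>)) \<in> Lp p 0 1"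
  have u: "u \<in> Lp p (of_int n) (of_int n + 1)" for n :: int
    using Lp_translation(1)[of "\<lambda>\<theta>. u (of_int n + \<theta>)" p "- of_int n" "of_int n" "of_int n + 1"] U by simp
  \<comment> \<open>The integers are encoded by naturals, as the gluing lemma requires;
    \<open>from_nat\<close> undoes the \<open>to_nat\<close> applied to
    \<open>\<lfloor>t\<rfloor>\<close>.\<close>
  define g where "g i = (\<lambda>t. indicator {of_int (from_nat i)<..<of_int (from_nat i) + 1} t *\<^sub>R u t)" for i
  have "strongly_measurable lebesgue (\<lambda>t. g (to_nat \<lfloor>t\<rfloor>) t)"
  proof (rule strongly_measurable_glue)
    show "(\<lambda>t::real. to_nat \<lfloor>t\<rfloor>) \<in> measurable lebesgue (count_space UNIV)"
      by (rule measurable_completion) measurable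
    show "strongly_measurable lebesgue (g i)" for i
      unfolding g_def using u by (intro strongly_measurable_extend) (auto simp: Lp_def)
  qed
  moreover have "AE t in lebesgue. g (to_nat \<lfloor>t\<rfloor>) t = u t"
    using AE_lebesgue_floor_neq
  proof eventually_elim
    case (elim t)
    then have "of_int \<lfloor>t\<rfloor> < t" "t < of_int \<lfloor>t\<rfloor> + 1" by linarith+
    then show ?case by (simp add: g_def)
  qed
  ultimately have sm: "strongly_measurable lebesgue u" by (rule strongly_measurable_cong)
  have "u \<in> Lp p a b" for a b
    unfolding Lp_eq_Lp_on
  proof (rule Lp_on_bound)
    let ?w = "\<lambda>n t. indicator {of_int n<..<of_int n + 1} t *\<^sub>R norm (u t) powr p"
    show "strongly_measurable (lebesgue_on {a<..<b}) u"
      using sm by (intro strongly_measurable_restrict_space) auto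
    have "integrable lebesgue (?w n)" for n
      using u[of n] by (subst integrable_restrict_space[symmetric]) (auto simp: Lp_def)
    then have "integrable lebesgue (\<lambda>t. \<Sum>n\<in>{\<lfloor>a\<rfloor>..\<lfloor>b\<rfloor>}. ?w n t)"
      by (intro Bochner_Integration.integrable_sum) auto
    then show "integrable (lebesgue_on {a<..<b}) (\<lambda>t. \<Sum>n\<in>{\<lfloor>a\<rfloor>..\<lfloor>b\<rfloor>}. ?w n t)"
      by (intro integrable_restrict_space[THEN iffD2] integrable_mult_indicator) auto
    show "AE t in lebesgue_on {a<..<b}. norm (u t) powr p \<le> (\<Sum>n\<in>{\<lfloor>a\<rfloor>..\<lfloor>b\<rfloor>}. ?w n t)"
    proof (subst AE_restrict_space_iff)
      show "AE t in lebesgue. t \<in> {a<..<b} \<longrightarrow> norm (u t) powr p \<le> (\<Sum>n\<in>{\<lfloor>a\<rfloor>..\<lfloor>b\<rfloor>}. ?w n t)"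
        using AE_lebesgue_floor_neq
      proof eventually_elim
        case (elim t)
        then have *: "of_int \<lfloor>t\<rfloor> < t" "t < of_int \<lfloor>t\<rfloor> + 1" by linarith+
        have "?w \<lfloor>t\<rfloor> t \<le> (\<Sum>n\<in>{\<lfloor>a\<rfloor>..\<lfloor>b\<rfloor>}. ?w n t)" if "t \<in> {a<..<b}"
          using that by (intro member_le_sum[of "\<lfloor>t\<rfloor>" _ "\<lambda>n. ?w n t"]) (auto intro: floor_mono)
        then show ?case using * by simp
      qed
    qed auto
  qed (use p in auto)
  then show "u \<in> Lp_loc p" by (simp add: Lp_loc_def)
qed

section \<open>Real translates controlled by integer pieces\<close>

lemma Lp_loc_translation: "u \<in> Lp_loc p \<Longrightarrow> (\<lambda>t. u (c + t)) \<in> Lp_loc p"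
  unfolding Lp_loc_def using Lp_translation(1) by blast

text \<open>Factor out one power and enlarge the base of the remaining exponent
  \<open>p - 1 \<ge> 0\<close>. It passes from integrals, which add over adjacent intervals, to
  norms.\<close>

lemma powr_add_superadditive:
  fixes a b p :: real
  assumes "1 \<le> p" "0 \<le> a" "0 \<le> b"
  shows "a powr p + b powr p \<le> (a + b) powr p"
proof -
  have *: "x powr p = x * x powr (p - 1)" if "0 \<le> x" for x :: real
    using that powr_add[of x 1 "p - 1"] by simp
  have "a powr p + b powr p \<le> a * (a + b) powr (p - 1) + b * (a + b) powr (p - 1)"
    unfolding *[OF assms(2)] *[OF assms(3)] using assms by (intro add_mono mult_left_mono powr_mono2) auto
  also have "\<dots> = (a + b) * (a + b) powr (p - 1)" by (rule distrib_right[symmetric])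
  also have "\<dots> = (a + b) powr p" using assms by (intro *[symmetric]) auto
  finally show ?thesis .
qed

text \<open>Up to one point, the interval from \<open>t\<close> to \<open>t + 1\<close> lies in two
  adjacent integer unit intervals; the integrals add, and superadditivity of the power allows roots
  to be taken.\<close>

lemma Lp_norm_translate_le:
  fixes u :: "real \<Rightarrow> 'a::banach"
  assumes p: "1 \<le> p" and u: "u \<in> Lp_loc p"
  shows "Lp_norm p 0 1 (\<lambda>\<theta>. u (t + \<theta>)) \<le>
    Lp_norm p 0 1 (\<lambda>\<theta>. u (of_int \<lfloor>t\<rfloor> + \<theta>)) + Lp_norm p 0 1 (\<lambda>\<theta>. u (of_int (\<lfloor>t\<rfloor> + 1) + \<theta>))"
proof -
  let ?w = "\<lambda>a t. indicator {a<..<a + 1} t *\<^sub>R norm (u t) powr p"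
  have L: "u \<in> Lp p a b" for a b using u by (simp add: Lp_loc_def)
  have eq: "Lp_norm p 0 1 (\<lambda>\<theta>. u (a + \<theta>)) = Lp_norm p a (a + 1) u" for a
    using Lp_translation(2)[of u p a 0 1] L by simp
  have int: "integrable lebesgue (?w a)" for a
    using L[of a "a + 1"] by (subst integrable_restrict_space[symmetric]) (auto simp: Lp_def)
  have pw: "Lp_norm p a (a + 1) u powr p = (LINT x|lebesgue. ?w a x)" for a
    using p by (simp add: Lp_norm_eq_Lp_seminorm Lp_seminorm_powr integral_restrict_space)
  define n where "n = real_of_int \<lfloor>t\<rfloor>"
  have n: "n \<le> t" "t < n + 1" unfolding n_def by linarith+
  \<comment> \<open>The point \<open>n + 1\<close> is the only one that both open integer intervals
    can miss.\<close>
  have "AE x in lebesgue. x \<notin> {n + 1}"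
    by (rule AE_not_in) auto
  then have "AE x in lebesgue. ?w t x \<le> ?w n x + ?w (n + 1) x"
    by eventually_elim (use n in \<open>auto split: split_indicator\<close>)
  then have "(LINT x|lebesgue. ?w t x) \<le> (LINT x|lebesgue. ?w n x + ?w (n + 1) x)"
    by (rule integral_mono_AE[OF int Bochner_Integration.integrable_add[OF int int]])
  also have "\<dots> = (LINT x|lebesgue. ?w n x) + (LINT x|lebesgue. ?w (n + 1) x)"
    using int by (intro Bochner_Integration.integral_add)
  finally have "Lp_norm p t (t + 1) u powr p \<le> Lp_norm p n (n + 1) u powr p + Lp_norm p (n + 1) (n + 1 + 1) u powr p"
    unfolding pw .
  also have "\<dots> \<le> (Lp_norm p n (n + 1) u + Lp_norm p (n + 1) (n + 1 + 1) u) powr p"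
    using p by (intro powr_add_superadditive) auto
  finally have "Lp_norm p t (t + 1) u powr p \<le> (Lp_norm p n (n + 1) u + Lp_norm p (n + 1) (n + 1 + 1) u) powr p" .
  then have "Lp_norm p t (t + 1) u \<le> Lp_norm p n (n + 1) u + Lp_norm p (n + 1) (n + 1 + 1) u"
    by (rule powr_le_cancel[rotated 3]) (use p in auto)
  then show ?thesis using eq[of t] eq[of n] eq[of "n + 1"] by (simp add: n_def)
qed

section \<open>Continuity of translations\<close>

text \<open>Regularity gives \<open>K \<subseteq> A \<subseteq> U\<close> with \<open>K\<close>
  compact, \<open>U\<close> open and small gaps. A small shift moves \<open>K\<close> within
  \<open>U\<close>, so wherever membership in \<open>A\<close> changes, \<open>x\<close> or
  \<open>h + x\<close> lies in a gap.\<close>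

lemma lmeasurable_translation_small:
  fixes A :: "real set"
  assumes A: "A \<in> sets lebesgue" "bounded A" and e: "e > 0"
  shows "\<forall>\<^sub>F h in at 0. \<exists>C\<in>lmeasurable. {x. (h + x \<in> A) \<noteq> (x \<in> A)} \<subseteq> C \<and> measure lebesgue C < e"
proof -
  obtain U where U: "open U" "A \<subseteq> U" "U - A \<in> lmeasurable" "emeasure lebesgue (U - A) < ennreal (e / 4)"
    using sets_lebesgue_outer_open[OF A(1), of "e / 4"] e by auto
  obtain K where K: "closed K" "K \<subseteq> A" "A - K \<in> lmeasurable" "emeasure lebesgue (A - K) < ennreal (e / 4)"
    using sets_lebesgue_inner_closed[OF A(1), of "e / 4"] e by auto
  have "compact K"
    using K(1,2) A(2) by (auto simp: compact_eq_bounded_closed intro: bounded_subset)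
  then obtain d where d: "d > 0" "(\<Union>x\<in>K. ball x d) \<subseteq> U"
    using compact_subset_open_imp_ball_epsilon_subset[of K U] U K by blast
  \<comment> \<open>Each gap has measure below \<open>e / 4\<close>; \<open>D\<close> together with
    its translate then stays below \<open>e\<close>.\<close>
  define D where "D = (U - A) \<union> (A - K)"
  have D: "D \<in> lmeasurable" using U K by (auto simp: D_def)
  have "measure lebesgue D \<le> measure lebesgue (U - A) + measure lebesgue (A - K)"
    unfolding D_def using U K by (intro measure_Un_le) auto
  also have "\<dots> < e / 4 + e / 4"
    using U(3,4) K(3,4) e by (intro add_strict_mono) (auto simp: emeasure_eq_measure2 ennreal_less_iff)
  finally have mD: "measure lebesgue D < e / 2" by simp
  have "\<exists>C\<in>lmeasurable. {x. (h + x \<in> A) \<noteq> (x \<in> A)} \<subseteq> C \<and> measure lebesgue C < e" if h: "\<bar>h\<bar> < d" for h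
  proof (intro bexI conjI)
    let ?C = "D \<union> (+) (- h) ` D"
    have D': "(+) (- h) ` D \<in> lmeasurable" by (rule measurable_translation[OF D])
    with D show "?C \<in> lmeasurable" by auto
    have "measure lebesgue ?C \<le> measure lebesgue D + measure lebesgue ((+) (- h) ` D)"
      using D D' by (intro measure_Un_le) auto
    then show "measure lebesgue ?C < e"
      using mD by (simp only: measure_translation)
    show "{x. (h + x \<in> A) \<noteq> (x \<in> A)} \<subseteq> ?C"
    proof
      fix x assume "x \<in> {x. (h + x \<in> A) \<noteq> (x \<in> A)}"
      then have x: "(h + x \<in> A) \<noteq> (x \<in> A)" by simp
      have 1: "h + x \<in> U" if "x \<in> K"
      proof -
        have "h + x \<in> ball x d" using h by (simp add: dist_real_def)
        then show ?thesis using d(2) that by blast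
      qed
      have "x \<in> U" if "h + x \<in> K"
      proof -
        have "x \<in> ball (h + x) d" using h by (simp add: dist_real_def)
        then show ?thesis using d(2) that by blast
      qed
      with 1 x K(2) U(2) have "x \<in> D \<or> h + x \<in> D" unfolding D_def by blast
      moreover have "x = - h + (h + x)" by simp
      ultimately show "x \<in> ?C" by (metis UnCI image_eqI)
    qed
  qed
  then show ?thesis
    using d(1) by (auto simp: eventually_at dist_real_def intro!: exI[of _ d])
qed

text \<open>If \<open>s\<close> changes under the shift, then \<open>x\<close> leaves the level set
  of \<open>s x\<close>, and there are finitely many level sets. The margins between the two
  intervals keep \<open>h + x\<close> inside the domain where \<open>s\<close> is
  controlled.\<close>

lemma simple_function_translation_small:
  fixes s :: "real \<Rightarrow> 'a"
  assumes s: "simple_function (lebesgue_on {a<..<b}) s" and ab: "a < a'" "b' < b" and e: "e > 0"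
  shows "\<forall>\<^sub>F h in at 0. \<exists>C\<in>lmeasurable. {x. a' < x \<and> x < b' \<and> s (h + x) \<noteq> s x} \<subseteq> C \<and> measure lebesgue C < e"
proof -
  define R where "R = s ` {a<..<b}"
  have R: "finite R" using simple_functionD(1)[OF s] by (simp add: R_def)
  define A where "A y = s -` {y} \<inter> {a<..<b}" for y
  have A: "A y \<in> sets lebesgue" "bounded (A y)" for y
    using simple_functionD(2)[OF s, of "{y}"] bounded_subset[of "{a<..<b}" "A y"]
    by (auto simp: A_def sets_restrict_space_iff)
  \<comment> \<open>The \<open>+ 1\<close> keeps the divisor positive and makes
    \<open>card R * c < e\<close> strict.\<close>
  define c where "c = e / (card R + 1)"
  have c: "c > 0" using e by (simp add: c_def)
  have "\<forall>\<^sub>F h in at 0. \<forall>y\<in>R. \<exists>C\<in>lmeasurable. {x. (h + x \<in> A y) \<noteq> (x \<in> A y)} \<subseteq> C \<and> measure lebesgue C < c"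
    using R lmeasurable_translation_small[OF A c] by (intro eventually_ball_finite) auto
  moreover have "\<forall>\<^sub>F h in at 0. \<bar>h\<bar> < min (a' - a) (b - b')"
    using ab unfolding eventually_at by (intro exI[of _ "min (a' - a) (b - b')"]) (auto simp: dist_real_def)
  ultimately show ?thesis
  proof eventually_elim
    case (elim h)
    then obtain C where C: "\<And>y. y \<in> R \<Longrightarrow> C y \<in> lmeasurable"
      "\<And>y. y \<in> R \<Longrightarrow> {x. (h + x \<in> A y) \<noteq> (x \<in> A y)} \<subseteq> C y"
      "\<And>y. y \<in> R \<Longrightarrow> measure lebesgue (C y) < c"
      by metis
    show ?case
    proof (intro bexI conjI)
      show "(\<Union>y\<in>R. C y) \<in> lmeasurable"
        using R C(1) by (intro fmeasurable.finite_UN) auto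
      have "measure lebesgue (\<Union>y\<in>R. C y) \<le> (\<Sum>y\<in>R. measure lebesgue (C y))"
        using R C(1) by (intro measure_UNION_le) auto
      also have "\<dots> \<le> card R * c"
        using C(3) by (intro sum_bounded_above) (auto intro: less_imp_le)
      also have "\<dots> < e" using e by (simp add: c_def field_simps)
      finally show "measure lebesgue (\<Union>y\<in>R. C y) < e" .
      show "{x. a' < x \<and> x < b' \<and> s (h + x) \<noteq> s x} \<subseteq> (\<Union>y\<in>R. C y)"
      proof
        fix x assume "x \<in> {x. a' < x \<and> x < b' \<and> s (h + x) \<noteq> s x}"
        then have x: "a' < x" "x < b'" "s (h + x) \<noteq> s x" by auto
        have "x \<in> {a<..<b}" "h + x \<in> {a<..<b}" using x ab elim(2) by auto
        then have "s x \<in> R" "(h + x \<in> A (s x)) \<noteq> (x \<in> A (s x))"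
          using x(3) by (auto simp: R_def A_def)
        then show "x \<in> (\<Union>y\<in>R. C y)" using C(2) by blast
      qed
    qed
  qed
qed

text \<open>By density the claim reduces to a simple function, which is bounded and changes only on
  a set of small measure. Approximation takes place on the interval from -1 to 2, which contains all
  translates of the unit interval with \<open>\<bar>h\<bar> < 1\<close>.\<close>

theorem Lp_translation_continuous:
  fixes w :: "real \<Rightarrow> 'a::banach"
  assumes p: "1 \<le> p" and w: "w \<in> Lp_loc p"
  shows "((\<lambda>h. Lp_norm p 0 1 (\<lambda>\<theta>. w (h + \<theta>) - w \<theta>)) \<longlongrightarrow> 0) (at 0)"
proof (rule tendstoI)
  fix e :: real assume e: "e > 0"
  have p0: "0 < p" using p by simp
  have wL: "w \<in> Lp p a b" for a b using w by (simp add: Lp_loc_def)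
  obtain s where s: "simple_function (lebesgue_on {-1<..<2}) s" "s \<in> Lp p (-1) 2" "Lp_norm p (-1) 2 (s - w) < e / 3"
    using Lp_on_simple_approx[of "lebesgue_on {-1<..<2}" p w "e / 3"] p wL e
    by (auto simp: Lp_eq_Lp_on Lp_norm_eq_Lp_seminorm)
  have sw: "s - w \<in> Lp p (-1) 2"
    using s(2) wL p unfolding Lp_eq_Lp_on by (intro Lp_on_diff) auto
  define R where "R = s ` {-1<..<2}"
  have R: "finite R" using simple_functionD(1)[OF s(1)] by (simp add: R_def)
  \<comment> \<open>\<open>B\<close> bounds the norm of \<open>s (h + x) - s x\<close>, and
    \<open>+ 1\<close> makes it a legitimate divisor. An exceptional set of measure below
    \<open>(e / 3 / B) powr p\<close> then contributes at most
    \<open>(e / 3) powr p\<close>.\<close>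
  define B where "B = 2 * (\<Sum>y\<in>R. norm y) + 1"
  have B: "B > 0" using sum_nonneg[of R norm] by (simp add: B_def)
  have nR: "norm (s x) \<le> (\<Sum>y\<in>R. norm y)" if "-1 < x" "x < 2" for x
    using R that by (intro member_le_sum[of "s x" R norm]) (auto simp: R_def)
  have "\<forall>\<^sub>F h in at 0. \<exists>C\<in>lmeasurable. {x. 0 < x \<and> x < 1 \<and> s (h + x) \<noteq> s x} \<subseteq> C \<and> measure lebesgue C < (e / 3 / B) powr p"
    using e B by (intro simple_function_translation_small[OF s(1)]) auto
  moreover have "\<forall>\<^sub>F h :: real in at 0. \<bar>h\<bar> < 1"
    unfolding eventually_at by (intro exI[of _ 1]) (auto simp: dist_real_def)
  ultimately show "\<forall>\<^sub>F h in at 0. dist (Lp_norm p 0 1 (\<lambda>\<theta>. w (h + \<theta>) - w \<theta>)) 0 < e"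
  proof eventually_elim
    case (elim h)
    then obtain C where C: "C \<in> lmeasurable" "{x. 0 < x \<and> x < 1 \<and> s (h + x) \<noteq> s x} \<subseteq> C"
      "measure lebesgue C < (e / 3 / B) powr p" by blast
    have tr: "(\<lambda>x. u (h + x)) \<in> Lp p 0 1" "Lp_norm p 0 1 (\<lambda>x. u (h + x)) \<le> Lp_norm p (-1) 2 u"
      if "u \<in> Lp p (-1) 2" for u :: "real \<Rightarrow> 'a"
      using Lp_subinterval[OF that p0, of "h + 0" "h + 1"] Lp_translation[of u p h 0 1] elim(2) by auto
    have sL: "s \<in> Lp p 0 1" "w \<in> Lp p 0 1" "s - w \<in> Lp p 0 1" "Lp_norm p 0 1 (s - w) \<le> Lp_norm p (-1) 2 (s - w)"
      using Lp_subinterval[OF s(2) p0, of 0 1] Lp_subinterval[OF sw p0, of 0 1] wL by auto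
    let ?J = "lebesgue_on {0<..<1::real}"
    have J: "complete_measure ?J" by simp
    let ?sh = "\<lambda>x. s (h + x)" and ?wh = "\<lambda>x. w (h + x)"
    have shL: "?sh \<in> Lp_on ?J p" "?wh \<in> Lp_on ?J p" "s \<in> Lp_on ?J p" "w \<in> Lp_on ?J p"
      using tr(1)[OF s(2)] tr(1)[OF wL] sL by (auto simp: Lp_eq_Lp_on)
    have "Lp_seminorm ?J p (?sh - s) \<le> e / 3"
    proof (rule Lp_seminorm_leI[OF p0])
      have "(LINT x|?J. norm ((?sh - s) x) powr p) = (LINT x|lebesgue. indicator {0<..<1} x *\<^sub>R norm ((?sh - s) x) powr p)"
        by (subst integral_restrict_space) auto
      also have "\<dots> \<le> (LINT x|lebesgue. B powr p * indicator C x)"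
      proof (rule integral_mono)
        have "integrable ?J (\<lambda>x. norm ((?sh - s) x) powr p)"
          by (intro Lp_onD(2) Lp_on_diff(1) J p shL)
        then show "integrable lebesgue (\<lambda>x. indicator {0<..<1} x *\<^sub>R norm ((?sh - s) x) powr p)"
          by (subst (asm) integrable_restrict_space) auto
        show "integrable lebesgue (\<lambda>x. B powr p * indicator C x)"
          using C(1) by (intro integrable_mult_right) (auto simp: fmeasurable_def)
        fix x
        show "indicator {0<..<1} x *\<^sub>R norm ((?sh - s) x) powr p \<le> B powr p * indicator C x"
        proof (cases "0 < x \<and> x < 1 \<and> s (h + x) \<noteq> s x")
          case True
          have "norm (s (h + x) - s x) \<le> norm (s (h + x)) + norm (s x)" by (rule norm_triangle_ineq4)
          also have "\<dots> \<le> B"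
          proof -
            have "- 1 < h + x" "h + x < 2" using True elim(2) by linarith+
            then show ?thesis using nR[of x] nR[of "h + x"] True by (simp add: B_def)
          qed
          finally have "norm (s (h + x) - s x) powr p \<le> B powr p" using p by (intro powr_mono2) auto
          then show ?thesis using True C(2) by (auto simp: indicator_def)
        next
          case False
          then show ?thesis using p0 by (auto simp: indicator_def)
        qed
      qed
      also have "\<dots> = B powr p * measure lebesgue C" using C(1) by simp
      also have "\<dots> \<le> B powr p * (e / 3 / B) powr p" using C(3) by (intro mult_left_mono) auto
      also have "\<dots> = (e / 3) powr p" using B e by (simp add: powr_mult[symmetric])
      finally show "(LINT x|?J. norm ((?sh - s) x) powr p) \<le> (e / 3) powr p" .
    qed (use e in auto)
    moreover have "Lp_seminorm ?J p (?sh - ?wh) < e / 3"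
    proof -
      have eq: "?sh - ?wh = (\<lambda>x. (s - w) (h + x))" by auto
      show ?thesis using tr(2)[OF sw] s(3) unfolding eq Lp_norm_eq_Lp_seminorm by simp
    qed
    moreover have "Lp_seminorm ?J p (s - w) < e / 3"
      using sL(4) s(3) by (simp add: Lp_norm_eq_Lp_seminorm)
    moreover have "Lp_seminorm ?J p (?wh - w) \<le> Lp_seminorm ?J p (?wh - ?sh) + (Lp_seminorm ?J p (?sh - s) + Lp_seminorm ?J p (s - w))"
      using Lp_seminorm_triangle[OF J p shL(2) shL(1) shL(4)] Lp_seminorm_triangle[OF J p shL(1) shL(3) shL(4)] by linarith
    ultimately have "Lp_seminorm ?J p (?wh - w) < e"
      by (simp only: Lp_seminorm_commute[of _ _ ?wh ?sh])
    moreover have "?wh - w = (\<lambda>\<theta>. w (h + \<theta>) - w \<theta>)" by auto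
    ultimately show ?case by (simp add: Lp_norm_eq_Lp_seminorm)
  qed
qed

section \<open>Almost automorphy along the integers\<close>

lemma Lp_diff: "1 \<le> p \<Longrightarrow> u \<in> Lp p a b \<Longrightarrow> v \<in> Lp p a b \<Longrightarrow> u - v \<in> Lp p a b"
  unfolding Lp_eq_Lp_on by (rule Lp_on_diff) auto

lemma Lp_norm_triangle:
  "1 \<le> p \<Longrightarrow> u \<in> Lp p a b \<Longrightarrow> v \<in> Lp p a b \<Longrightarrow> w \<in> Lp p a b \<Longrightarrow>
    Lp_norm p a b (u - w) \<le> Lp_norm p a b (u - v) + Lp_norm p a b (v - w)"
  unfolding Lp_eq_Lp_on Lp_norm_eq_Lp_seminorm by (rule Lp_seminorm_triangle) auto

lemma Lp_norm_commute: "Lp_norm p a b (u - v) = Lp_norm p a b (v - u)"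
  unfolding Lp_norm_eq_Lp_seminorm by (rule Lp_seminorm_commute)

lemma Lp_norm_le_add_diff:
  assumes "1 \<le> p" "u \<in> Lp p a b" "v \<in> Lp p a b"
  shows "Lp_norm p a b u \<le> Lp_norm p a b (u - v) + Lp_norm p a b v"
proof -
  have "(\<lambda>_. 0) \<in> Lp p a b" by (simp add: Lp_eq_Lp_on)
  from Lp_norm_triangle[OF assms this] show ?thesis by (simp add: fun_diff_def)
qed

lemma Lp_complete:
  assumes "1 \<le> p" "\<And>n. u n \<in> Lp p a b"
    and "\<And>e. e > 0 \<Longrightarrow> \<exists>N. \<forall>m\<ge>N. \<forall>n\<ge>N. Lp_norm p a b (u m - u n) < e"
  obtains v where "v \<in> Lp p a b" "(\<lambda>n. Lp_norm p a b (u n - v)) \<longlonglongrightarrow> 0"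
proof -
  have "complete_measure (lebesgue_on {a<..<b})" by simp
  then show thesis
    using assms that unfolding Lp_eq_Lp_on Lp_norm_eq_Lp_seminorm by (rule Lp_on_complete)
qed

lemma bochner_transform_diff: "bochner_transform (u - v) t = bochner_transform u t - bochner_transform v t"
  by (auto simp: bochner_transform_def)

lemma bochner_transform_in_Lp: "u \<in> Lp_loc p \<Longrightarrow> bochner_transform u t \<in> Lp p 0 1"
  unfolding bochner_transform_def using Lp_loc_translation[of u p t] by (simp add: Lp_loc_def)

lemma Lp_loc_diff: "1 \<le> p \<Longrightarrow> u \<in> Lp_loc p \<Longrightarrow> v \<in> Lp_loc p \<Longrightarrow> u - v \<in> Lp_loc p"
  by (simp add: Lp_loc_def Lp_diff)

lemma bochner_transform_continuous:
  assumes p: "1 \<le> p" and u: "u \<in> Lp_loc p" and X: "X \<longlonglongrightarrow> t"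
  shows "(\<lambda>k. Lp_norm p 0 1 (bochner_transform u (X k) - bochner_transform u t)) \<longlonglongrightarrow> 0"
proof -
  define F where "F h = Lp_norm p 0 1 (\<lambda>\<theta>. u (t + (h + \<theta>)) - u (t + \<theta>))" for h
  have "F \<midarrow>0\<rightarrow> 0"
    unfolding F_def using Lp_translation_continuous[OF p Lp_loc_translation[OF u, of t]] .
  \<comment> \<open>The value at 0 turns the punctured limit into continuity, since
    \<open>X k\<close> may equal \<open>t\<close>.\<close>
  moreover have "F 0 = 0" using p by (simp add: F_def Lp_norm_def)
  ultimately have "isCont F 0" by (simp add: isCont_def)
  moreover have "(\<lambda>k. X k - t) \<longlonglongrightarrow> 0" using X by (simp add: LIM_zero)
  ultimately have "(\<lambda>k. F (X k - t)) \<longlonglongrightarrow> F 0" by (rule isCont_tendsto_compose)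
  moreover have "F (X k - t) = Lp_norm p 0 1 (bochner_transform u (X k) - bochner_transform u t)" for k
    unfolding F_def bochner_transform_def by (rule arg_cong[of _ _ "Lp_norm p 0 1"]) (auto simp: fun_eq_iff algebra_simps)
  ultimately show ?thesis using \<open>F 0 = 0\<close> by simp
qed

text \<open>A shift by at most 1 changes the floor by at most 1, and two consecutive integer pieces
  are needed, hence the offsets from -1 to 2. The bound is independent of \<open>h\<close>, so
  \<open>h\<close> may later vary along a sequence.\<close>

lemma Lp_norm_bochner_transform_le:
  fixes g :: "real \<Rightarrow> 'a::banach"
  assumes p: "1 \<le> p" and g: "g \<in> Lp_loc p" and h: "\<bar>h\<bar> \<le> 1"
  shows "Lp_norm p 0 1 (bochner_transform g (t + h)) \<le>
    (\<Sum>j\<in>{-1..2}. Lp_norm p 0 1 (bochner_transform g (of_int (\<lfloor>t\<rfloor> + j))))"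
proof -
  define j where "j = \<lfloor>t + h\<rfloor> - \<lfloor>t\<rfloor>"
  have "\<lfloor>t + h\<rfloor> \<le> \<lfloor>t\<rfloor> + 1" "\<lfloor>t\<rfloor> - 1 \<le> \<lfloor>t + h\<rfloor>" using h by linarith+
  then have j: "{j, j + 1} \<subseteq> {-1..2}" by (auto simp: j_def)
  have "Lp_norm p 0 1 (bochner_transform g (t + h)) \<le>
      (\<Sum>j\<in>{j, j + 1}. Lp_norm p 0 1 (bochner_transform g (of_int (\<lfloor>t\<rfloor> + j))))"
    using Lp_norm_translate_le[OF p g, of "t + h"] by (simp add: bochner_transform_def j_def algebra_simps)
  also have "\<dots> \<le> (\<Sum>j\<in>{-1..2}. Lp_norm p 0 1 (bochner_transform g (of_int (\<lfloor>t\<rfloor> + j))))"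
    using j by (intro sum_mono2) auto
  finally show ?thesis .
qed

section \<open>Limits of sequences of unit pieces under integer shifts\<close>

definition shift_limit ::
    "real \<Rightarrow> (nat \<Rightarrow> int) \<Rightarrow> (int \<Rightarrow> real \<Rightarrow> 'a::banach) \<Rightarrow> (int \<Rightarrow> real \<Rightarrow> 'a) \<Rightarrow> bool" where
  "shift_limit p m U V \<longleftrightarrow> (\<forall>n. V n \<in> Lp p 0 1) \<and>
     (\<forall>n. (\<lambda>k. Lp_norm p 0 1 (U (n + m k) - V n)) \<longlonglongrightarrow> 0 \<and>
          (\<lambda>k. Lp_norm p 0 1 (V (n - m k) - U n)) \<longlonglongrightarrow> 0)"

text \<open>Convergence along a fixed shift sequence is split off as \<open>shift_limit\<close>, so
  that a single subsequence can serve countably many sequences of pieces.\<close>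

definition aa_seq :: "real \<Rightarrow> (int \<Rightarrow> real \<Rightarrow> 'a::banach) \<Rightarrow> bool" where
  "aa_seq p U \<longleftrightarrow> (\<forall>n. U n \<in> Lp p 0 1) \<and>
     (\<forall>m :: nat \<Rightarrow> int. \<exists>r :: nat \<Rightarrow> nat. strict_mono r \<and> (\<exists>V. shift_limit p (m \<circ> r) U V))"

lemma shift_limitD:
  assumes "shift_limit p m U V"
  shows "V n \<in> Lp p 0 1" "(\<lambda>k. Lp_norm p 0 1 (U (n + m k) - V n)) \<longlonglongrightarrow> 0"
    "(\<lambda>k. Lp_norm p 0 1 (V (n - m k) - U n)) \<longlonglongrightarrow> 0"
  using assms by (auto simp: shift_limit_def)

lemma shift_limit_subseq:
  assumes "strict_mono r" "shift_limit p m U V"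
  shows "shift_limit p (m \<circ> r) U V"
  using assms(2) LIMSEQ_subseq_LIMSEQ[OF _ assms(1)] unfolding shift_limit_def o_def by blast

lemma aa_seq_diagonal:
  fixes U :: "nat \<Rightarrow> int \<Rightarrow> real \<Rightarrow> 'a::banach" and m :: "nat \<Rightarrow> int"
  assumes U: "\<And>i. aa_seq p (U i)"
  obtains r where "strict_mono r" "\<And>i. \<exists>V. shift_limit p (m \<circ> r) (U i) V"
proof -
  have "\<exists>r. strict_mono r \<and> (\<exists>V. shift_limit p (m \<circ> (s \<circ> r)) (U i) V)" for i and s :: "nat \<Rightarrow> nat"
    using U[of i] unfolding aa_seq_def comp_assoc[symmetric] by blast
  then interpret subseqs "\<lambda>i s. \<exists>V. shift_limit p (m \<circ> s) (U i) V"
    by unfold_locales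
  have "\<exists>V. shift_limit p (m \<circ> diagseq) (U i) V" for i
  proof -
    \<comment> \<open>After its first \<open>Suc i\<close> terms the diagonal is a subsequence of
      the one chosen for \<open>U i\<close>; dropping finitely many terms does not affect the
      limits.\<close>
    have "\<exists>V. shift_limit p (m \<circ> (diagseq \<circ> (+) (Suc i))) (U i) V"
      by (rule diagseq_holds) (metis comp_assoc shift_limit_subseq)
    then obtain V where V: "shift_limit p (m \<circ> (diagseq \<circ> (+) (Suc i))) (U i) V" by blast
    have "(\<lambda>k. Lp_norm p 0 1 (U i (n + (m \<circ> diagseq) k) - V n)) \<longlonglongrightarrow> 0" for n
      by (rule LIMSEQ_offset[where k="Suc i"]) (use shift_limitD(2)[OF V, of n] in \<open>simp add: add.commute\<close>)
    moreover have "(\<lambda>k. Lp_norm p 0 1 (V (n - (m \<circ> diagseq) k) - U i n)) \<longlonglongrightarrow> 0" for n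
      by (rule LIMSEQ_offset[where k="Suc i"]) (use shift_limitD(3)[OF V, of n] in \<open>simp add: add.commute\<close>)
    ultimately have "shift_limit p (m \<circ> diagseq) (U i) V"
      using shift_limitD(1)[OF V] unfolding shift_limit_def by blast
    then show ?thesis by blast
  qed
  with subseq_diagseq show thesis by (rule that)
qed

text \<open>Approximation by \<open>W j\<close>, uniform in \<open>n\<close>, makes
  \<open>U (n + m k)\<close> Cauchy in \<open>k\<close>, and completeness supplies the limit. The
  return limit needs the same uniformity, because it evaluates the limit pieces at the moving index
  \<open>n - m k\<close>.\<close>

lemma shift_limit_closed:
  fixes U :: "int \<Rightarrow> real \<Rightarrow> 'a::banach"
  assumes p: "1 \<le> p" and U: "\<And>n. U n \<in> Lp p 0 1" and W: "\<And>j n. W j n \<in> Lp p 0 1"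
    and lim: "\<And>j::nat. shift_limit p m (W j) (V j)"
    and unif: "\<And>e. e > 0 \<Longrightarrow> \<exists>j. \<forall>n. Lp_norm p 0 1 (W j n - U n) < e"
  shows "\<exists>V'. shift_limit p m U V'"
proof -
  let ?N = "Lp_norm p 0 1"
  note tri = Lp_norm_triangle[OF p]
  have V: "V j n \<in> Lp p 0 1" for j n using lim by (rule shift_limitD)
  have "\<exists>v. v \<in> Lp p 0 1 \<and> (\<lambda>k. ?N (U (n + m k) - v)) \<longlonglongrightarrow> 0" for n
  proof -
    have "\<exists>N. \<forall>k\<ge>N. \<forall>l\<ge>N. ?N (U (n + m k) - U (n + m l)) < e" if e: "e > 0" for e
    proof -
      obtain j where j: "\<And>n. ?N (W j n - U n) < e / 4" using unif[of "e / 4"] e by auto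
      have "\<forall>\<^sub>F k in sequentially. ?N (W j (n + m k) - V j n) < e / 4"
        using shift_limitD(2)[OF lim] e by (intro order_tendstoD(2)) auto
      then obtain N where N: "\<And>k. k \<ge> N \<Longrightarrow> ?N (W j (n + m k) - V j n) < e / 4"
        by (auto simp: eventually_sequentially)
      have *: "?N (U (n + m k) - V j n) < e / 2" if "k \<ge> N" for k
        using tri[OF U W V, of "n + m k" j n j "n + m k"] j[of "n + m k"] N[OF that]
        by (simp add: Lp_norm_commute[of _ _ _ "U _"])
      have "?N (U (n + m k) - U (n + m l)) < e" if "k \<ge> N" "l \<ge> N" for k l
        using tri[OF U V U, of "n + m k" "n + m l" j n] *[OF that(1)] *[OF that(2)]
        by (simp add: Lp_norm_commute[of _ _ _ "V _ _"])
      then show ?thesis by blast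
    qed
    then obtain v where "v \<in> Lp p 0 1" "(\<lambda>k. ?N (U (n + m k) - v)) \<longlonglongrightarrow> 0"
      using Lp_complete[OF p, of "\<lambda>k. U (n + m k)"] U by metis
    then show ?thesis by blast
  qed
  then obtain V' where V': "\<And>n. V' n \<in> Lp p 0 1" "\<And>n. (\<lambda>k. ?N (U (n + m k) - V' n)) \<longlonglongrightarrow> 0"
    by metis
  \<comment> \<open>Uniform closeness of \<open>W j\<close> and \<open>U\<close> passes to their
    shift limits, with an estimate independent of \<open>n\<close>.\<close>
  have close: "?N (V' n - V j n) \<le> e" if j: "\<And>n. ?N (W j n - U n) < e" for j n e
  proof (rule LIMSEQ_le_const)
    show "(\<lambda>k. ?N (U (n + m k) - V' n) + e + ?N (W j (n + m k) - V j n)) \<longlonglongrightarrow> e"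
      using tendsto_add[OF tendsto_add[OF V'(2)[of n] tendsto_const[of e]] shift_limitD(2)[OF lim, of j n]] by simp
    have "?N (V' n - V j n) \<le> ?N (U (n + m k) - V' n) + e + ?N (W j (n + m k) - V j n)" for k
      using tri[OF V'(1) U V, of n j n "n + m k"] tri[OF U W V, of "n + m k" j n j "n + m k"] j[of "n + m k"]
        Lp_norm_commute[of p 0 1 "V' n" "U (n + m k)"] Lp_norm_commute[of p 0 1 "U (n + m k)" "W j (n + m k)"]
      by linarith
    then show "\<exists>N. \<forall>k\<ge>N. ?N (V' n - V j n) \<le> ?N (U (n + m k) - V' n) + e + ?N (W j (n + m k) - V j n)" by blast
  qed
  have "(\<lambda>k. ?N (V' (n - m k) - U n)) \<longlonglongrightarrow> 0" for n
  proof (rule LIMSEQ_I)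
    fix e :: real assume e: "e > 0"
    obtain j where j: "\<And>n. ?N (W j n - U n) < e / 3" using unif[of "e / 3"] e by auto
    have "\<forall>\<^sub>F k in sequentially. ?N (V j (n - m k) - W j n) < e / 3"
      using shift_limitD(3)[OF lim] e by (intro order_tendstoD(2)) auto
    then obtain N where N: "\<And>k. k \<ge> N \<Longrightarrow> ?N (V j (n - m k) - W j n) < e / 3"
      by (auto simp: eventually_sequentially)
    have "norm (?N (V' (n - m k) - U n) - 0) < e" if "k \<ge> N" for k
      using tri[OF V'(1) V U, of "n - m k" n j "n - m k"] tri[OF V W U, of j "n - m k" n j n]
        close[OF j, of "n - m k"] N[OF that] j[of n] by simp
    then show "\<exists>N. \<forall>k\<ge>N. norm (?N (V' (n - m k) - U n) - 0) < e" by blast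
  qed
  with V' show ?thesis unfolding shift_limit_def by blast
qed

lemma aa_seq_closed:
  fixes U :: "int \<Rightarrow> real \<Rightarrow> 'a::banach"
  assumes p: "1 \<le> p" and U: "\<And>n. U n \<in> Lp p 0 1" and W: "\<And>j::nat. aa_seq p (W j)"
    and unif: "\<And>e. e > 0 \<Longrightarrow> \<exists>j. \<forall>n. Lp_norm p 0 1 (W j n - U n) < e"
  shows "aa_seq p U"
  unfolding aa_seq_def
proof (intro conjI allI)
  fix m :: "nat \<Rightarrow> int"
  obtain r where r: "strict_mono r" "\<And>j. \<exists>V. shift_limit p (m \<circ> r) (W j) V"
    by (rule aa_seq_diagonal[OF W, of m], rule that)
  then obtain V where "\<And>j. shift_limit p (m \<circ> r) (W j) (V j)" by metis
  moreover have "W j n \<in> Lp p 0 1" for j n using W[of j] by (simp add: aa_seq_def)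
  ultimately have "\<exists>V'. shift_limit p (m \<circ> r) U V'"
    using unif by (intro shift_limit_closed[OF p U]) blast+
  with r(1) show "\<exists>r. strict_mono r \<and> (\<exists>V. shift_limit p (m \<circ> r) U V)" by blast
qed (rule U)

section \<open>From integer pieces to functions on the line\<close>

lemma bochner_transform_glue:
  fixes V :: "int \<Rightarrow> real \<Rightarrow> 'a"
  assumes "0 < \<theta>" "\<theta> < 1"
  shows "bochner_transform (\<lambda>t. V \<lfloor>t\<rfloor> (t - of_int \<lfloor>t\<rfloor>)) (of_int n) \<theta> = V n \<theta>"
proof -
  have "\<lfloor>of_int n + \<theta>\<rfloor> = n" using assms by linarith
  then show ?thesis by (simp add: bochner_transform_def)
qed

lemma Lp_loc_glue:
  fixes V :: "int \<Rightarrow> real \<Rightarrow> 'a::banach"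
  assumes p: "1 \<le> p" and V: "\<And>n. V n \<in> Lp p 0 1"
  shows "(\<lambda>t. V \<lfloor>t\<rfloor> (t - of_int \<lfloor>t\<rfloor>)) \<in> Lp_loc p"
proof -
  have "bochner_transform (\<lambda>t. V \<lfloor>t\<rfloor> (t - of_int \<lfloor>t\<rfloor>)) (of_int n) \<in> Lp p 0 1" for n
    using p by (intro Lp_cong[OF _ V[of n]] bochner_transform_glue[symmetric]) auto
  then show ?thesis unfolding Lp_loc_iff[OF p] by (simp add: bochner_transform_def)
qed

lemma SpaaE:
  fixes u :: "real \<Rightarrow> 'a::banach" and s :: "nat \<Rightarrow> real"
  assumes "u \<in> Spaa p"
  obtains r v where "strict_mono r" "\<And>t. v t \<in> Lp p 0 1"
    "\<And>t. (\<lambda>k. Lp_norm p 0 1 (bochner_transform u (t + s (r k)) - v t)) \<longlonglongrightarrow> 0"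
    "\<And>t. (\<lambda>k. Lp_norm p 0 1 (v (t - s (r k)) - bochner_transform u t)) \<longlonglongrightarrow> 0"
proof -
  have "\<forall>s :: nat \<Rightarrow> real. \<exists>r :: nat \<Rightarrow> nat. strict_mono r \<and>
       (\<exists>v. (\<forall>t. v t \<in> Lp p 0 1) \<and>
         (\<forall>t. (\<lambda>k. Lp_norm p 0 1 (bochner_transform u (t + s (r k)) - v t)) \<longlonglongrightarrow> 0 \<and>
              (\<lambda>k. Lp_norm p 0 1 (v (t - s (r k)) - bochner_transform u t)) \<longlonglongrightarrow> 0))"
    using assms by (simp add: Spaa_def AA_def)
  from this[rule_format, of s] show thesis using that by blast
qed

text \<open>One direction specializes to integer shifts and integer times. For the converse the
  limit pieces are glued to a function on the line, whose translate by the limiting fractional part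
  gives the limit for real shifts.\<close>

theorem Spaa_iff_aa_seq:
  fixes u :: "real \<Rightarrow> 'a::banach"
  assumes p: "1 \<le> p"
  shows "u \<in> Spaa p \<longleftrightarrow> aa_seq p (\<lambda>n. bochner_transform u (of_int n))"
proof
  assume u: "u \<in> Spaa p"
  have "\<exists>r. strict_mono r \<and> (\<exists>V. shift_limit p (m \<circ> r) (\<lambda>n. bochner_transform u (of_int n)) V)"
    for m :: "nat \<Rightarrow> int"
  proof -
    obtain r v where r: "strict_mono r" and v: "\<And>t. v t \<in> Lp p 0 1"
      "\<And>t. (\<lambda>k. Lp_norm p 0 1 (bochner_transform u (t + of_int (m (r k))) - v t)) \<longlonglongrightarrow> 0"
      "\<And>t. (\<lambda>k. Lp_norm p 0 1 (v (t - of_int (m (r k))) - bochner_transform u t)) \<longlonglongrightarrow> 0"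
      using SpaaE[OF u, of "\<lambda>k. real_of_int (m k)"] by blast
    have "shift_limit p (m \<circ> r) (\<lambda>n. bochner_transform u (of_int n)) (\<lambda>n. v (of_int n))"
      unfolding shift_limit_def using v(1) v(2,3)[of "of_int _"] by simp
    with r show ?thesis by blast
  qed
  moreover have "bochner_transform u t \<in> Lp p 0 1" for t
    using u by (simp add: Spaa_def bochner_transform_in_Lp)
  ultimately show "aa_seq p (\<lambda>n. bochner_transform u (of_int n))"
    by (simp add: aa_seq_def)
next
  let ?U = "\<lambda>n. bochner_transform u (of_int n)" and ?N = "Lp_norm p 0 1" and ?bt = bochner_transform
  assume aa: "aa_seq p ?U"
  have u: "u \<in> Lp_loc p"
    unfolding Lp_loc_iff[OF p] using aa by (simp add: aa_seq_def bochner_transform_def)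
  note tri = Lp_norm_triangle[OF p]
  have "\<exists>r. strict_mono r \<and> (\<exists>v. (\<forall>t. v t \<in> Lp p 0 1) \<and>
      (\<forall>t. (\<lambda>k. ?N (?bt u (t + s (r k)) - v t)) \<longlonglongrightarrow> 0 \<and> (\<lambda>k. ?N (v (t - s (r k)) - ?bt u t)) \<longlonglongrightarrow> 0))"
    for s :: "nat \<Rightarrow> real"
  proof -
    have "\<forall>k. frac (s k) \<in> {0..1}" by (auto simp: frac_ge_0 less_imp_le[OF frac_lt_1])
    then obtain \<tau> r1 where r1: "\<tau> \<in> {0..1}" "strict_mono r1" "((\<lambda>k. frac (s k)) \<circ> r1) \<longlonglongrightarrow> \<tau>"
      using compact_Icc[of "0::real" 1] unfolding compact_def by metis
    obtain r2 V where r2: "strict_mono r2" "shift_limit p ((\<lambda>k. \<lfloor>s (r1 k)\<rfloor>) \<circ> r2) ?U V"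
      using aa unfolding aa_seq_def by blast
    define r where "r = r1 \<circ> r2"
    define m where "m k = \<lfloor>s (r k)\<rfloor>" for k
    define \<sigma> where "\<sigma> k = frac (s (r k))" for k
    have s: "s (r k) = of_int (m k) + \<sigma> k" for k by (simp add: m_def \<sigma>_def frac_def)
    have \<sigma>: "\<sigma> \<longlonglongrightarrow> \<tau>" using LIMSEQ_subseq_LIMSEQ[OF r1(3) r2(1)] by (simp add: o_def r_def \<sigma>_def[abs_def])
    have \<sigma>01: "0 \<le> \<sigma> k" "\<sigma> k \<le> 1" for k by (auto simp: \<sigma>_def frac_ge_0 less_imp_le[OF frac_lt_1])
    have V: "shift_limit p m ?U V" using r2(2) by (simp add: o_def r_def m_def[abs_def])
    define v where "v = (\<lambda>t. V \<lfloor>t\<rfloor> (t - of_int \<lfloor>t\<rfloor>))"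
    have v: "v \<in> Lp_loc p" unfolding v_def using shift_limitD(1)[OF V] by (rule Lp_loc_glue[OF p])
    have bv: "?bt v (of_int n) \<theta> = V n \<theta>" if "0 < \<theta>" "\<theta> < 1" for n \<theta>
      unfolding v_def using that by (rule bochner_transform_glue)
    \<comment> \<open>Convergence to 0 of all integer pieces implies convergence at
      \<open>t + h k\<close>, even though \<open>h k\<close> varies, because finitely many integer
      pieces dominate every bounded shift.\<close>
    have small: "(\<lambda>k. ?N (?bt (g k) (t + h k))) \<longlonglongrightarrow> 0"
      if g: "\<And>k. g k \<in> Lp_loc p" and lim: "\<And>n. (\<lambda>k. ?N (?bt (g k) (of_int n))) \<longlonglongrightarrow> 0"
        and h: "\<And>k. \<bar>h k\<bar> \<le> 1" for g :: "nat \<Rightarrow> real \<Rightarrow> 'a" and t h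
    proof (rule tendsto_sandwich[OF _ _ tendsto_const])
      show "(\<lambda>k. \<Sum>j\<in>{-1..2}. ?N (?bt (g k) (of_int (\<lfloor>t\<rfloor> + j)))) \<longlonglongrightarrow> 0"
        by (intro tendsto_null_sum lim)
      show "\<forall>\<^sub>F k in sequentially. ?N (?bt (g k) (t + h k)) \<le> (\<Sum>j\<in>{-1..2}. ?N (?bt (g k) (of_int (\<lfloor>t\<rfloor> + j))))"
        by (intro always_eventually allI Lp_norm_bochner_transform_le p g h)
    qed simp
    \<comment> \<open>Since \<open>s (r k)\<close> is \<open>m k\<close> plus the fractional part
      \<open>\<sigma> k\<close>, with \<open>\<sigma>\<close> tending to \<open>\<tau>\<close>, the
      limit is the glued function translated by \<open>\<tau>\<close>.\<close>
    define v' where "v' t = ?bt v (t + \<tau>)" for t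
    have "v' t \<in> Lp p 0 1" for t unfolding v'_def by (rule bochner_transform_in_Lp[OF v])
    moreover have "(\<lambda>k. ?N (?bt u (t + s (r k)) - v' t)) \<longlonglongrightarrow> 0" for t
    proof -
      define g where "g k = (\<lambda>y. u (of_int (m k) + y)) - v" for k
      have "(\<lambda>k. ?N (?bt (g k) (of_int n))) \<longlonglongrightarrow> 0" for n
      proof -
        have "?N (?bt (g k) (of_int n)) = ?N (?U (n + m k) - V n)" for k
          by (rule Lp_norm_cong)
            (simp add: g_def bochner_transform_diff bv, simp add: bochner_transform_def algebra_simps)
        then show ?thesis using shift_limitD(2)[OF V, of n] by simp
      qed
      moreover have "g k \<in> Lp_loc p" for k
        unfolding g_def by (intro Lp_loc_diff p Lp_loc_translation u v)
      ultimately have "(\<lambda>k. ?N (?bt (g k) (t + \<sigma> k))) \<longlonglongrightarrow> 0"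
        using \<sigma>01 by (intro small) auto
      moreover have "?bt (g k) (t + \<sigma> k) = ?bt u (t + s (r k)) - ?bt v (t + \<sigma> k)" for k
        by (auto simp: g_def bochner_transform_def s algebra_simps)
      ultimately have 1: "(\<lambda>k. ?N (?bt u (t + s (r k)) - ?bt v (t + \<sigma> k))) \<longlonglongrightarrow> 0" by simp
      have 2: "(\<lambda>k. ?N (?bt v (t + \<sigma> k) - v' t)) \<longlonglongrightarrow> 0"
        unfolding v'_def by (intro bochner_transform_continuous p v tendsto_intros \<sigma>)
      show ?thesis
      proof (rule tendsto_sandwich[OF _ _ tendsto_const])
        show "(\<lambda>k. ?N (?bt u (t + s (r k)) - ?bt v (t + \<sigma> k)) + ?N (?bt v (t + \<sigma> k) - v' t)) \<longlonglongrightarrow> 0"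
          using tendsto_add[OF 1 2] by simp
        show "\<forall>\<^sub>F k in sequentially. ?N (?bt u (t + s (r k)) - v' t)
            \<le> ?N (?bt u (t + s (r k)) - ?bt v (t + \<sigma> k)) + ?N (?bt v (t + \<sigma> k) - v' t)"
          unfolding v'_def by (intro always_eventually allI tri bochner_transform_in_Lp u v)
      qed simp
    qed
    moreover have "(\<lambda>k. ?N (v' (t - s (r k)) - ?bt u t)) \<longlonglongrightarrow> 0" for t
    proof -
      \<comment> \<open>Shifting back by \<open>s (r k)\<close> leaves the offset
        \<open>\<tau> - \<sigma> k\<close>, which is bounded by 1 and tends to 0: the bound permits
        \<open>small\<close>, the limit permits continuity of the transform of
        \<open>u\<close>.\<close>
      define g where "g k = (\<lambda>y. v (- of_int (m k) + y)) - u" for k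
      have "(\<lambda>k. ?N (?bt (g k) (of_int n))) \<longlonglongrightarrow> 0" for n
      proof -
        have "?N (?bt (g k) (of_int n)) = ?N (V (n - m k) - ?U n)" for k
        proof (rule Lp_norm_cong)
          fix x :: real assume "0 < x" "x < 1"
          then have "V (n - m k) x = ?bt v (of_int (n - m k)) x" by (simp only: bv)
          then show "?bt (g k) (of_int n) x = (V (n - m k) - ?U n) x"
            by (simp add: g_def bochner_transform_def algebra_simps)
        qed
        then show ?thesis using shift_limitD(3)[OF V, of n] by simp
      qed
      moreover have "g k \<in> Lp_loc p" for k
        unfolding g_def by (intro Lp_loc_diff p Lp_loc_translation u v)
      moreover have "\<bar>\<tau> - \<sigma> k\<bar> \<le> 1" for k using r1(1) \<sigma>01[of k] by (auto simp: abs_le_iff)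
      ultimately have "(\<lambda>k. ?N (?bt (g k) (t + (\<tau> - \<sigma> k)))) \<longlonglongrightarrow> 0"
        by (intro small)
      moreover have "?bt (g k) (t + (\<tau> - \<sigma> k)) = v' (t - s (r k)) - ?bt u (t + (\<tau> - \<sigma> k))" for k
        by (auto simp: g_def v'_def bochner_transform_def s algebra_simps)
      ultimately have 1: "(\<lambda>k. ?N (v' (t - s (r k)) - ?bt u (t + (\<tau> - \<sigma> k)))) \<longlonglongrightarrow> 0" by simp
      have "(\<lambda>k. t + (\<tau> - \<sigma> k)) \<longlonglongrightarrow> t + (\<tau> - \<tau>)" by (intro tendsto_intros \<sigma>)
      then have 2: "(\<lambda>k. ?N (?bt u (t + (\<tau> - \<sigma> k)) - ?bt u t)) \<longlonglongrightarrow> 0"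
        by (intro bochner_transform_continuous p u) simp
      show ?thesis
      proof (rule tendsto_sandwich[OF _ _ tendsto_const])
        show "(\<lambda>k. ?N (v' (t - s (r k)) - ?bt u (t + (\<tau> - \<sigma> k))) + ?N (?bt u (t + (\<tau> - \<sigma> k)) - ?bt u t)) \<longlonglongrightarrow> 0"
          using tendsto_add[OF 1 2] by simp
        show "\<forall>\<^sub>F k in sequentially. ?N (v' (t - s (r k)) - ?bt u t)
            \<le> ?N (v' (t - s (r k)) - ?bt u (t + (\<tau> - \<sigma> k))) + ?N (?bt u (t + (\<tau> - \<sigma> k)) - ?bt u t)"
          unfolding v'_def by (intro always_eventually allI tri bochner_transform_in_Lp u v)
      qed simp
    qed
    moreover have "strict_mono r" unfolding r_def using r1(2) r2(1) by (rule strict_mono_o)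
    ultimately show ?thesis by blast
  qed
  moreover have "((\<lambda>s. ?N (?bt u s - ?bt u t)) \<longlongrightarrow> 0) (at t)" for t
    unfolding tendsto_at_iff_sequentially o_def using bochner_transform_continuous[OF p u] by blast
  ultimately show "u \<in> Spaa p"
    using u bochner_transform_in_Lp[OF u] by (simp add: Spaa_def AA_def cont_maps_def)
qed

text \<open>Unbounded norms along some \<open>s\<close> contradict almost automorphy: a subsequence
  of the pieces at \<open>s k\<close> converges at time 0, hence is bounded.\<close>

lemma Spaa_subset_BSp:
  fixes u :: "real \<Rightarrow> 'a::banach"
  assumes p: "1 \<le> p" and u: "u \<in> Spaa p"
  shows "u \<in> BSp p"
proof -
  let ?N = "Lp_norm p 0 1" and ?bt = bochner_transform
  have L: "?bt u t \<in> Lp p 0 1" for t using u by (simp add: Spaa_def bochner_transform_in_Lp)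
  have "\<exists>B. \<forall>t. ?N (?bt u t) \<le> B"
  proof (rule ccontr)
    assume "\<not> ?thesis"
    then have "\<forall>k::nat. \<exists>t. real k < ?N (?bt u t)" by (auto simp: not_le)
    then obtain s where s: "\<And>k::nat. real k < ?N (?bt u (s k))" by metis
    obtain r w where r: "strict_mono r" and w: "\<And>t. w t \<in> Lp p 0 1"
      "\<And>t. (\<lambda>k. ?N (?bt u (t + s (r k)) - w t)) \<longlonglongrightarrow> 0"
      by (rule SpaaE[OF u, of s], rule that)
    define v where "v = w 0"
    have v: "v \<in> Lp p 0 1" "(\<lambda>k. ?N (?bt u (s (r k)) - v)) \<longlonglongrightarrow> 0"
      using w(1) w(2)[of 0] by (simp_all add: v_def)
    have "\<forall>\<^sub>F k in sequentially. ?N (?bt u (s (r k)) - v) < 1"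
      by (rule order_tendstoD(2)[OF v(2)]) simp
    moreover have "\<forall>\<^sub>F k in sequentially. 1 + ?N v < real k"
      using filterlim_real_sequentially unfolding filterlim_at_top_dense by blast
    ultimately have "\<forall>\<^sub>F k::nat in sequentially. False"
    proof eventually_elim
      case (elim k)
      have "real k \<le> real (r k)" using seq_suble[OF r, of k] by simp
      also have "\<dots> < ?N (?bt u (s (r k)))" by (rule s)
      also have "\<dots> \<le> ?N (?bt u (s (r k)) - v) + ?N v" by (rule Lp_norm_le_add_diff[OF p L v(1)])
      finally show False using elim by simp
    qed
    then show False by simp
  qed
  then show ?thesis using u by (simp add: BSp_def BC_def Spaa_def AA_def)
qed

text \<open>Membership in \<open>BSp\<close> bounds both transforms, so the real-valued
  \<open>SUP\<close> in \<open>Sp_norm\<close> is a genuine upper bound.\<close>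

lemma Lp_norm_le_Sp_norm:
  assumes p: "1 \<le> p" and u: "u \<in> BSp p" and v: "v \<in> BSp p"
  shows "Lp_norm p 0 1 (bochner_transform u t - bochner_transform v t) \<le> Sp_norm p (u - v)"
proof -
  obtain A B where AB: "\<And>t. Lp_norm p 0 1 (bochner_transform u t) \<le> A" "\<And>t. Lp_norm p 0 1 (bochner_transform v t) \<le> B"
    using u v unfolding BSp_def BC_def by blast
  have L: "bochner_transform u t \<in> Lp p 0 1" "bochner_transform v t \<in> Lp p 0 1" for t
    using u v by (auto simp: BSp_def bochner_transform_in_Lp)
  have "Lp_norm p 0 1 (bochner_transform (u - v) t) \<le> A + B" for t
    using Lp_on_diff(2)[OF _ p L[unfolded Lp_eq_Lp_on], of t t] AB[of t]
    by (simp add: bochner_transform_diff Lp_norm_eq_Lp_seminorm)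
  then have "bdd_above (range (\<lambda>t. Lp_norm p 0 1 (bochner_transform (u - v) t)))" by (intro bdd_aboveI) auto
  then show ?thesis
    unfolding Sp_norm_def bochner_transform_diff[symmetric] by (rule cSUP_upper[OF UNIV_I])
qed

text \<open>The factor 2 counts the two integer pieces that control one real translate; later
  applications divide their thresholds by 3 to absorb it.\<close>

lemma Sp_norm_leI:
  fixes u v :: "real \<Rightarrow> 'a::banach"
  assumes p: "1 \<le> p" and u: "u \<in> Lp_loc p" and v: "v \<in> Lp_loc p"
    and le: "\<And>n::int. Lp_norm p 0 1 (bochner_transform u (of_int n) - bochner_transform v (of_int n)) \<le> c"
  shows "Sp_norm p (u - v) \<le> 2 * c"
  unfolding Sp_norm_def
proof (rule cSUP_least)
  fix t
  show "Lp_norm p 0 1 (bochner_transform (u - v) t) \<le> 2 * c"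
    using Lp_norm_translate_le[OF p Lp_loc_diff[OF p u v], of t] le[of "\<lfloor>t\<rfloor>"] le[of "\<lfloor>t\<rfloor> + 1"]
    unfolding bochner_transform_diff[symmetric] by (simp add: bochner_transform_def)
qed simp

text \<open>All integer pieces are at seminorm distance 0 from each other, so the sequence of pieces
  is its own limit along every integer shift sequence.\<close>

lemma Lp_periodic_subset_Spaa:
  fixes u :: "real \<Rightarrow> 'a::banach"
  assumes p: "1 \<le> p" and u: "u \<in> Lp_periodic p"
  shows "u \<in> Spaa p"
proof -
  let ?U = "\<lambda>n::int. bochner_transform u (of_int n)" and ?N = "Lp_norm p 0 1"
  have U: "?U n \<in> Lp p 0 1" for n using u by (simp add: Lp_periodic_def bochner_transform_in_Lp)
  have step: "?N (?U (n + 1) - ?U n) = 0" for n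
  proof -
    have T: "(\<lambda>x. real_of_int n + x) \<in> measurable lebesgue lebesgue"
      using lebesgue_affine_measurable[of "\<lambda>_. 1" "of_int n :: real"] by simp
    have d: "distr lebesgue lebesgue (\<lambda>x. real_of_int n + x) = lebesgue"
      using lebesgue_real_affine[of 1 "of_int n"] by (simp add: density_1)
    have "AE t in distr lebesgue lebesgue (\<lambda>x. real_of_int n + x). u (t + 1) = u t"
      unfolding d using u by (simp add: Lp_periodic_def)
    then have "AE t in lebesgue. u (of_int n + t + 1) = u (of_int n + t)"
      by (rule AE_distrD[OF T])
    then have "AE t in lebesgue_on {0<..<1}. (?U (n + 1) - ?U n) t = (\<lambda>_. 0) t"
      by (subst AE_restrict_space_iff) (auto elim!: eventually_mono simp: bochner_transform_def algebra_simps)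
    from Lp_seminorm_cong[OF _ _ Lp_diff[OF p U U, unfolded Lp_eq_Lp_on] this] p
    show ?thesis by (simp add: Lp_norm_eq_Lp_seminorm fun_diff_def)
  qed
  have "?N (?U n - ?U 0) \<le> 0" for n
  proof (induction n rule: int_induct[where k=0])
    case base
    then show ?case using p by (simp add: Lp_norm_def)
  next
    case (step1 i)
    then show ?case using Lp_norm_triangle[OF p U U U, of "i + 1" 0 i] step[of i] by linarith
  next
    case (step2 i)
    moreover have "?N (?U i - ?U (i - 1)) = 0" using step[of "i - 1"] by simp
    ultimately show ?case
      using Lp_norm_triangle[OF p U U U, of "i - 1" 0 i] Lp_norm_commute[of p 0 1 "?U (i - 1)" "?U i"] by linarith
  qed
  then have "?N (?U n - ?U n') = 0" for n n'
    using Lp_norm_triangle[OF p U U U, of n n' 0] Lp_norm_nonneg[of p 0 1 "?U n - ?U n'"]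
      Lp_norm_commute[of p 0 1 "?U 0" "?U n'"] by (smt (verit))
  then have "shift_limit p m ?U ?U" for m
    using U unfolding shift_limit_def by (simp del: of_int_add of_int_diff)
  then have "aa_seq p ?U"
    using U strict_mono_id unfolding aa_seq_def by blast
  then show ?thesis by (simp add: Spaa_iff_aa_seq[OF p])
qed

section \<open>The Nemytskii operator\<close>

text \<open>At each point the power of the glued function is one summand of a finite sum over the
  values of \<open>h\<close>. This extends statements about constants to simple functions.\<close>

lemma Lp_on_piecewise:
  fixes h :: "'s \<Rightarrow> 'a" and G :: "'a \<Rightarrow> 's \<Rightarrow> 'b::banach"
  assumes M: "complete_measure M" and p: "0 < p" and h: "simple_function M h"
    and G: "\<And>x. x \<in> h ` space M \<Longrightarrow> G x \<in> Lp_on M p"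
  shows "(\<lambda>t. G (h t) t) \<in> Lp_on M p"
    and "Lp_seminorm M p (\<lambda>t. G (h t) t) powr p \<le> (\<Sum>x\<in>h ` space M. Lp_seminorm M p (G x) powr p)"
proof -
  let ?R = "h ` space M" and ?g = "\<lambda>t. G (h t) t"
  have R: "finite ?R" by (rule simple_functionD(1)[OF h])
  \<comment> \<open>The gluing lemma requires a strongly measurable function for every natural
    index; those beyond the number of values of \<open>h\<close> get the zero function.\<close>
  define g where "g i = (if i < card ?R then G (from_nat_into ?R i) else (\<lambda>_. 0))" for i
  have idx: "to_nat_on ?R (h t) < card ?R" "from_nat_into ?R (to_nat_on ?R (h t)) = h t" if "t \<in> space M" for t
    using that to_nat_on_finite[OF R] countable_finite[OF R] by (auto dest!: bij_betwE)
  have "strongly_measurable M (\<lambda>t. g (to_nat_on ?R (h t)) t)"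
  proof (rule strongly_measurable_glue)
    show "(\<lambda>t. to_nat_on ?R (h t)) \<in> measurable M (count_space UNIV)"
      using simple_function_compose1[OF h, of "to_nat_on ?R"] by (rule measurable_simple_function)
    show "strongly_measurable M (g i)" for i
    proof (cases "i < card ?R")
      case True
      then have "from_nat_into ?R i \<in> ?R" by (intro from_nat_into) auto
      then show ?thesis using True G Lp_onD(1) by (auto simp: g_def)
    next
      case False
      then show ?thesis by (simp add: g_def strongly_measurable_simple)
    qed
  qed
  then have sm: "strongly_measurable M ?g"
    by (rule strongly_measurable_cong) (use idx in \<open>auto simp: g_def intro!: AE_I2\<close>)
  have int: "integrable M (\<lambda>t. \<Sum>x\<in>?R. norm (G x t) powr p)"
    by (rule Bochner_Integration.integrable_sum) (rule Lp_onD(2)[OF G])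
  have le: "norm (?g t) powr p \<le> (\<Sum>x\<in>?R. norm (G x t) powr p)" if "t \<in> space M" for t
    using that R by (intro member_le_sum[of "h t" ?R "\<lambda>x. norm (G x t) powr p"]) auto
  show mem: "?g \<in> Lp_on M p"
    by (rule Lp_on_bound[OF M p sm int]) (intro AE_I2 le)
  have "Lp_seminorm M p ?g powr p = (LINT t|M. norm (?g t) powr p)"
    by (rule Lp_seminorm_powr[OF p])
  also have "\<dots> \<le> (LINT t|M. (\<Sum>x\<in>?R. norm (G x t) powr p))"
    by (rule integral_mono[OF Lp_onD(2)[OF mem] int le])
  also have "\<dots> = (\<Sum>x\<in>?R. (LINT t|M. norm (G x t) powr p))"
    by (rule Bochner_Integration.integral_sum) (rule Lp_onD(2)[OF G])
  also have "\<dots> = (\<Sum>x\<in>?R. Lp_seminorm M p (G x) powr p)"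
    by (simp only: Lp_seminorm_powr[OF p])
  finally show "Lp_seminorm M p ?g powr p \<le> (\<Sum>x\<in>?R. Lp_seminorm M p (G x) powr p)" .
qed

lemma const_in_Lp_periodic:
  assumes p: "1 \<le> p"
  shows "(\<lambda>_. x) \<in> Lp_periodic p"
proof -
  have "(\<lambda>_. x) \<in> Lp p 0 1"
    by (auto simp: Lp_def intro!: strongly_measurable_simple finite_measure.integrable_const finite_measure_lebesgue_on)
  then show ?thesis by (simp add: Lp_periodic_def Lp_loc_iff[OF p])
qed

text \<open>The assumptions are assertion (iii), together with the ranges of the exponents; the
  context serves to derive assertion (i).\<close>

locale nemytskii_on_periodic =
  fixes f :: "real \<times> 'x::banach \<Rightarrow> 'y::banach" and p q :: real
  assumes p: "1 \<le> p" and q: "1 \<le> q"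
    and const: "\<And>x. (\<lambda>t. f (t, x)) \<in> Spaa q"
    and periodic: "\<And>u. u \<in> Lp_periodic p \<Longrightarrow> nemytskii f u \<in> BSp q"
    and cont: "seminorm_continuous_on (Lp_periodic p) (Sp_norm p) (Sp_norm q) (nemytskii f)"
begin

section \<open>Superposition acting on unit pieces\<close>

definition F :: "int \<Rightarrow> (real \<Rightarrow> 'x) \<Rightarrow> real \<Rightarrow> 'y" where
  "F n w = (\<lambda>\<theta>. f (of_int n + \<theta>, w \<theta>))"

definition periodize :: "(real \<Rightarrow> 'x) \<Rightarrow> real \<Rightarrow> 'x" where
  "periodize w t = w (t - of_int \<lfloor>t\<rfloor>)"

lemma bochner_transform_nemytskii: "bochner_transform (nemytskii f u) (of_int n) = F n (bochner_transform u (of_int n))"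
  by (simp add: bochner_transform_def nemytskii_def F_def)

lemma bochner_transform_periodize:
  "0 < \<theta> \<Longrightarrow> \<theta> < 1 \<Longrightarrow> bochner_transform (periodize w) (of_int n) \<theta> = w \<theta>"
  using bochner_transform_glue[of \<theta> "\<lambda>_. w" n] by (simp add: periodize_def[abs_def])

lemma periodize_in_Lp_periodic:
  assumes "w \<in> Lp p 0 1"
  shows "periodize w \<in> Lp_periodic p"
  using Lp_loc_glue[OF p, of "\<lambda>_. w"] assms by (simp add: Lp_periodic_def periodize_def[abs_def])

lemma F_in_Lp:
  assumes w: "w \<in> Lp p 0 1"
  shows "F n w \<in> Lp q 0 1"
proof -
  have "nemytskii f (periodize w) \<in> Lp_loc q"
    using periodic[OF periodize_in_Lp_periodic[OF w]] by (simp add: BSp_def)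
  then have *: "F n (bochner_transform (periodize w) (of_int n)) \<in> Lp q 0 1"
    unfolding bochner_transform_nemytskii[symmetric] by (rule bochner_transform_in_Lp)
  show ?thesis
    by (rule Lp_cong[OF _ *]) (use q in \<open>auto simp: F_def bochner_transform_periodize\<close>)
qed

text \<open>All integer pieces of the periodic extension of \<open>w\<close> coincide with
  \<open>w\<close>, while the Stepanov norm of the image dominates all pieces \<open>F n w\<close>
  at once. One \<open>d\<close> therefore works for every \<open>n\<close>.\<close>

lemma F_equicontinuous:
  assumes w: "w \<in> Lp p 0 1" and e: "e > 0"
  obtains d where "d > 0"
    "\<And>w' n. w' \<in> Lp p 0 1 \<Longrightarrow> Lp_norm p 0 1 (w' - w) < d \<Longrightarrow> Lp_norm q 0 1 (F n w' - F n w) < e"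
proof -
  obtain d where d: "d > 0" "\<And>v. v \<in> Lp_periodic p \<Longrightarrow> Sp_norm p (v - periodize w) < d \<Longrightarrow>
      Sp_norm q (nemytskii f v - nemytskii f (periodize w)) < e"
    using cont periodize_in_Lp_periodic[OF w] e unfolding seminorm_continuous_on_def by metis
  \<comment> \<open>With \<open>d / 3\<close>, the factor 2 of \<open>Sp_norm_leI\<close> still
    leaves a Stepanov distance strictly below \<open>d\<close>.\<close>
  have "Lp_norm q 0 1 (F n w' - F n w) < e"
    if w': "w' \<in> Lp p 0 1" and less: "Lp_norm p 0 1 (w' - w) < d / 3" for w' n
  proof -
    note per = periodize_in_Lp_periodic[OF w'] periodize_in_Lp_periodic[OF w]
    have "Lp_norm p 0 1 (bochner_transform (periodize w') (of_int n) - bochner_transform (periodize w) (of_int n))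
        = Lp_norm p 0 1 (w' - w)" for n :: int
      by (rule Lp_norm_cong) (simp add: bochner_transform_periodize)
    then have "Sp_norm p (periodize w' - periodize w) \<le> 2 * (d / 3)"
      using per less by (intro Sp_norm_leI p) (auto simp: Lp_periodic_def)
    then have "Sp_norm q (nemytskii f (periodize w') - nemytskii f (periodize w)) < e"
      using d(1) by (intro d(2) per) simp
    moreover have "Lp_norm q 0 1 (bochner_transform (nemytskii f (periodize w')) (of_int n)
        - bochner_transform (nemytskii f (periodize w)) (of_int n)) = Lp_norm q 0 1 (F n w' - F n w)"
      unfolding bochner_transform_nemytskii by (rule Lp_norm_cong) (simp add: F_def bochner_transform_periodize)
    ultimately show ?thesis
      using Lp_norm_le_Sp_norm[OF q periodic[OF per(1)] periodic[OF per(2)], of "of_int n"] by simp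
  qed
  with d(1) show thesis by (intro that[of "d / 3"]) auto
qed

section \<open>Almost automorphy of superposed sequences\<close>

lemma aa_seq_F_const: "aa_seq q (\<lambda>n. F n (\<lambda>_. x))"
  using const[of x] unfolding Spaa_iff_aa_seq[OF q] by (simp add: bochner_transform_def F_def)

text \<open>On a level set of \<open>s\<close> the piece \<open>F n s\<close> is that of a constant,
  and these sets are the same for all \<open>n\<close>; the limits for the finitely many constants
  are glued along \<open>s\<close>.\<close>

lemma aa_seq_F_simple:
  assumes s: "simple_function (lebesgue_on {0<..<1}) s" "s \<in> Lp p 0 1"
  shows "aa_seq q (\<lambda>n. F n s)"
  unfolding aa_seq_def
proof (intro conjI allI)
  show "F n s \<in> Lp q 0 1" for n by (rule F_in_Lp[OF s(2)])
next
  fix m :: "nat \<Rightarrow> int"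
  let ?J = "lebesgue_on {0<..<1::real}"
  let ?R = "s ` space ?J"
  have J: "complete_measure ?J" by simp
  have R: "finite ?R" by (rule simple_functionD(1)[OF s(1)])
  obtain r where r: "strict_mono r"
    "\<And>i. \<exists>V. shift_limit q (m \<circ> r) (\<lambda>n. F n (\<lambda>_. from_nat_into ?R i)) V"
    by (rule aa_seq_diagonal[OF aa_seq_F_const, of m "\<lambda>i. from_nat_into ?R i"], rule that)
  have "\<exists>V. shift_limit q (m \<circ> r) (\<lambda>n. F n (\<lambda>_. x)) V" if "x \<in> ?R" for x
    using r(2)[of "to_nat_on ?R x"] that countable_finite[OF R] by simp
  then obtain V where V: "\<And>x. x \<in> ?R \<Longrightarrow> shift_limit q (m \<circ> r) (\<lambda>n. F n (\<lambda>_. x)) (V x)"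
    by metis
  have q0: "0 < q" using q by simp
  have FL: "F n (\<lambda>_. x) \<in> Lp q 0 1" for n x using aa_seq_F_const[of x] by (simp add: aa_seq_def)
  define V' where "V' n \<theta> = V (s \<theta>) n \<theta>" for n \<theta>
  have "V' n \<in> Lp q 0 1" for n
    unfolding V'_def[abs_def] Lp_eq_Lp_on
    by (rule Lp_on_piecewise(1)[OF J q0 s(1)]) (rule shift_limitD(1)[OF V, unfolded Lp_eq_Lp_on])
  moreover have to0: "(\<lambda>k. Lp_norm q 0 1 (g k)) \<longlonglongrightarrow> 0"
    if G: "\<And>k x. x \<in> ?R \<Longrightarrow> G k x \<in> Lp q 0 1" and lim: "\<And>x. x \<in> ?R \<Longrightarrow> (\<lambda>k. Lp_norm q 0 1 (G k x)) \<longlonglongrightarrow> 0"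
      and g: "\<And>k \<theta>. g k \<theta> = G k (s \<theta>) \<theta>" for g and G :: "nat \<Rightarrow> 'x \<Rightarrow> real \<Rightarrow> 'y"
  proof -
    have le: "Lp_norm q 0 1 (g k) powr q \<le> (\<Sum>x\<in>?R. Lp_norm q 0 1 (G k x) powr q)" for k
      using Lp_on_piecewise(2)[OF J q0 s(1), of "G k"] G g[of k, abs_def] by (simp add: Lp_eq_Lp_on Lp_norm_eq_Lp_seminorm)
    have "(\<lambda>k. \<Sum>x\<in>?R. Lp_norm q 0 1 (G k x) powr q) \<longlonglongrightarrow> (\<Sum>x\<in>?R. 0 powr q)"
      using q0 by (intro tendsto_sum tendsto_powr2 lim tendsto_const) auto
    then have "(\<lambda>k. \<Sum>x\<in>?R. Lp_norm q 0 1 (G k x) powr q) \<longlonglongrightarrow> 0" using q0 by simp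
    then have "(\<lambda>k. Lp_norm q 0 1 (g k) powr q) \<longlonglongrightarrow> 0"
      by (rule tendsto_sandwich[OF _ _ tendsto_const, rotated 2]) (use le in auto)
    then have "(\<lambda>k. (Lp_norm q 0 1 (g k) powr q) powr (1 / q)) \<longlonglongrightarrow> 0 powr (1 / q)"
      using q0 by (intro tendsto_powr2) auto
    then show ?thesis using q0 by (simp add: powr_powr)
  qed
  have "(\<lambda>k. Lp_norm q 0 1 (F (n + (m \<circ> r) k) s - V' n)) \<longlonglongrightarrow> 0" for n
  proof (rule to0[of "\<lambda>k x. F (n + (m \<circ> r) k) (\<lambda>_. x) - V x n"])
    show "F (n + (m \<circ> r) k) (\<lambda>_. x) - V x n \<in> Lp q 0 1" if "x \<in> ?R" for k x
      by (rule Lp_diff[OF q FL shift_limitD(1)[OF V[OF that]]])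
    show "(\<lambda>k. Lp_norm q 0 1 (F (n + (m \<circ> r) k) (\<lambda>_. x) - V x n)) \<longlonglongrightarrow> 0" if "x \<in> ?R" for x
      by (rule shift_limitD(2)[OF V[OF that]])
  qed (simp add: F_def V'_def)
  moreover have "(\<lambda>k. Lp_norm q 0 1 (V' (n - (m \<circ> r) k) - F n s)) \<longlonglongrightarrow> 0" for n
  proof (rule to0[of "\<lambda>k x. V x (n - (m \<circ> r) k) - F n (\<lambda>_. x)"])
    show "V x (n - (m \<circ> r) k) - F n (\<lambda>_. x) \<in> Lp q 0 1" if "x \<in> ?R" for k x
      by (rule Lp_diff[OF q shift_limitD(1)[OF V[OF that]] FL])
    show "(\<lambda>k. Lp_norm q 0 1 (V x (n - (m \<circ> r) k) - F n (\<lambda>_. x))) \<longlonglongrightarrow> 0" if "x \<in> ?R" for x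
      by (rule shift_limitD(3)[OF V[OF that]])
  qed (simp add: F_def V'_def)
  ultimately have "shift_limit q (m \<circ> r) (\<lambda>n. F n s) V'"
    unfolding shift_limit_def by blast
  with r(1) show "\<exists>r. strict_mono r \<and> (\<exists>V. shift_limit q (m \<circ> r) (\<lambda>n. F n s) V)" by blast
qed

text \<open>Equicontinuity at \<open>w\<close> makes approximation by simple functions uniform in
  \<open>n\<close>, as closure under uniform limits demands.\<close>

lemma aa_seq_F:
  assumes w: "w \<in> Lp p 0 1"
  shows "aa_seq q (\<lambda>n. F n w)"
proof -
  have "\<exists>s. simple_function (lebesgue_on {0<..<1}) s \<and> s \<in> Lp p 0 1 \<and> Lp_norm p 0 1 (s - w) < inverse (real (Suc j))" for j
    using Lp_on_simple_approx[of "lebesgue_on {0<..<1}" p w "inverse (real (Suc j))"] p w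
    unfolding Lp_eq_Lp_on Lp_norm_eq_Lp_seminorm by (auto simp del: of_nat_Suc)
  then obtain s where s: "\<And>j. simple_function (lebesgue_on {0<..<1}) (s j)" "\<And>j. s j \<in> Lp p 0 1"
    "\<And>j. Lp_norm p 0 1 (s j - w) < inverse (real (Suc j))" by metis
  show ?thesis
  proof (rule aa_seq_closed[OF q F_in_Lp[OF w], of "\<lambda>j n. F n (s j)"])
    show "aa_seq q (\<lambda>n. F n (s j))" for j by (rule aa_seq_F_simple[OF s(1,2)])
    fix e :: real assume e: "e > 0"
    obtain d where d: "d > 0"
      "\<And>w' n. w' \<in> Lp p 0 1 \<Longrightarrow> Lp_norm p 0 1 (w' - w) < d \<Longrightarrow> Lp_norm q 0 1 (F n w' - F n w) < e"
      by (rule F_equicontinuous[OF w e], rule that)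
    obtain j where "inverse (real (Suc j)) < d" using reals_Archimedean[OF d(1)] by blast
    then have "Lp_norm p 0 1 (s j - w) < d" using s(3)[of j] by linarith
    then show "\<exists>j. \<forall>n. Lp_norm q 0 1 (F n (s j) - F n w) < e" using d(2) s(2) by blast
  qed
qed

lemma aa_seq_F_seq:
  assumes U: "aa_seq p U"
  shows "aa_seq q (\<lambda>n. F n (U n))"
  unfolding aa_seq_def
proof (intro conjI allI)
  have UL: "U n \<in> Lp p 0 1" for n using U by (simp add: aa_seq_def)
  show "F n (U n) \<in> Lp q 0 1" for n by (rule F_in_Lp[OF UL])
  fix m :: "nat \<Rightarrow> int"
  obtain r1 V where r1: "strict_mono r1" "shift_limit p (m \<circ> r1) U V"
    using U unfolding aa_seq_def by blast
  note VL = shift_limitD(1)[OF r1(2)]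
  \<comment> \<open>All arguments at which limits are evaluated lie in this countable set, so a
    diagonal subsequence provides limits \<open>G w\<close> for all of them simultaneously.\<close>
  define D where "D = range U \<union> range V"
  have D: "countable D" "D \<noteq> {}" by (auto simp: D_def)
  have DL: "w \<in> Lp p 0 1" if "w \<in> D" for w using that UL VL by (auto simp: D_def)
  obtain r2 where r2: "strict_mono r2"
    "\<And>i. \<exists>G. shift_limit q ((m \<circ> r1) \<circ> r2) (\<lambda>n. F n (from_nat_into D i)) G"
    by (rule aa_seq_diagonal[OF aa_seq_F[OF DL[OF from_nat_into[OF D(2)]]], of "m \<circ> r1" id], rule that) auto
  define \<mu> where "\<mu> = (m \<circ> r1) \<circ> r2"
  have "\<exists>G. shift_limit q \<mu> (\<lambda>n. F n w) G" if "w \<in> D" for w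
    using r2(2)[of "to_nat_on D w"] that D(1) by (simp add: \<mu>_def)
  then obtain G where G: "\<And>w. w \<in> D \<Longrightarrow> shift_limit q \<mu> (\<lambda>n. F n w) (G w)" by metis
  have V: "shift_limit p \<mu> U V" unfolding \<mu>_def by (rule shift_limit_subseq[OF r2(1) r1(2)])
  note GL = shift_limitD(1)[OF G]
  note tri = Lp_norm_triangle[OF q]
  let ?N = "Lp_norm q 0 1"
  have UD: "U n \<in> D" and VD: "V n \<in> D" for n by (auto simp: D_def)
  \<comment> \<open>Closeness of \<open>F n w'\<close> and \<open>F n w\<close> for all
    \<open>n\<close> is inherited by the limits, so equicontinuity extends to \<open>G\<close> on
    \<open>D\<close>.\<close>
  have G_equi: "?N (G w' i - G w i) \<le> e"
    if ww: "w \<in> D" "w' \<in> D" and le: "\<And>n. ?N (F n w' - F n w) \<le> e" for w w' i e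
  proof (rule LIMSEQ_le_const)
    show "(\<lambda>k. ?N (F (i + \<mu> k) w' - G w' i) + e + ?N (F (i + \<mu> k) w - G w i)) \<longlonglongrightarrow> e"
      using tendsto_add[OF tendsto_add[OF shift_limitD(2)[OF G[OF ww(2)], of i] tendsto_const[of e]]
        shift_limitD(2)[OF G[OF ww(1)], of i]] by simp
    have "?N (G w' i - G w i) \<le> ?N (F (i + \<mu> k) w' - G w' i) + e + ?N (F (i + \<mu> k) w - G w i)" for k
      using tri[OF GL[OF ww(2), of i] F_in_Lp[OF DL[OF ww(2)], of "i + \<mu> k"] GL[OF ww(1), of i]]
        tri[OF F_in_Lp[OF DL[OF ww(2)], of "i + \<mu> k"] F_in_Lp[OF DL[OF ww(1)], of "i + \<mu> k"] GL[OF ww(1), of i]]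
        le[of "i + \<mu> k"] Lp_norm_commute[of q 0 1 "G w' i" "F (i + \<mu> k) w'"] by linarith
    then show "\<exists>N. \<forall>k\<ge>N. ?N (G w' i - G w i) \<le> ?N (F (i + \<mu> k) w' - G w' i) + e + ?N (F (i + \<mu> k) w - G w i)"
      by blast
  qed
  \<comment> \<open>The limit of the nonlinearity is evaluated at the limit \<open>V n\<close> of
    its arguments.\<close>
  define V' where "V' n = G (V n) n" for n
  have "(\<lambda>k. ?N (F (n + \<mu> k) (U (n + \<mu> k)) - V' n)) \<longlonglongrightarrow> 0" for n
  proof (rule LIMSEQ_I)
    fix e :: real assume e: "e > 0"
    obtain d where d: "d > 0"
      "\<And>w' i. w' \<in> Lp p 0 1 \<Longrightarrow> Lp_norm p 0 1 (w' - V n) < d \<Longrightarrow> ?N (F i w' - F i (V n)) < e / 2"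
      by (rule F_equicontinuous[OF VL half_gt_zero[OF e], of n], rule that)
    have "\<forall>\<^sub>F k in sequentially. Lp_norm p 0 1 (U (n + \<mu> k) - V n) < d"
      by (rule order_tendstoD(2)[OF shift_limitD(2)[OF V] d(1)])
    moreover have "\<forall>\<^sub>F k in sequentially. ?N (F (n + \<mu> k) (V n) - G (V n) n) < e / 2"
      by (rule order_tendstoD(2)[OF shift_limitD(2)[OF G[OF VD]] half_gt_zero[OF e]])
    ultimately have "\<forall>\<^sub>F k in sequentially. norm (?N (F (n + \<mu> k) (U (n + \<mu> k)) - V' n) - 0) < e"
    proof eventually_elim
      case (elim k)
      have "?N (F (n + \<mu> k) (U (n + \<mu> k)) - F (n + \<mu> k) (V n)) < e / 2"
        by (rule d(2)[OF UL elim(1)])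
      with elim(2) show ?case
        using tri[OF F_in_Lp[OF UL[of "n + \<mu> k"], of "n + \<mu> k"] F_in_Lp[OF VL[of n], of "n + \<mu> k"] GL[OF VD[of n], of n]]
        unfolding V'_def real_norm_def diff_0_right abs_of_nonneg[OF Lp_norm_nonneg] by linarith
    qed
    then show "\<exists>N. \<forall>k\<ge>N. norm (?N (F (n + \<mu> k) (U (n + \<mu> k)) - V' n) - 0) < e"
      by (simp only: eventually_sequentially)
  qed
  moreover have "(\<lambda>k. ?N (V' (n - \<mu> k) - F n (U n))) \<longlonglongrightarrow> 0" for n
  proof (rule LIMSEQ_I)
    fix e :: real assume e: "e > 0"
    obtain d where d: "d > 0"
      "\<And>w' i. w' \<in> Lp p 0 1 \<Longrightarrow> Lp_norm p 0 1 (w' - U n) < d \<Longrightarrow> ?N (F i w' - F i (U n)) < e / 2"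
      by (rule F_equicontinuous[OF UL half_gt_zero[OF e], of n], rule that)
    have "\<forall>\<^sub>F k in sequentially. Lp_norm p 0 1 (V (n - \<mu> k) - U n) < d"
      by (rule order_tendstoD(2)[OF shift_limitD(3)[OF V] d(1)])
    moreover have "\<forall>\<^sub>F k in sequentially. ?N (G (U n) (n - \<mu> k) - F n (U n)) < e / 2"
      by (rule order_tendstoD(2)[OF shift_limitD(3)[OF G[OF UD]] half_gt_zero[OF e]])
    ultimately have "\<forall>\<^sub>F k in sequentially. norm (?N (V' (n - \<mu> k) - F n (U n)) - 0) < e"
    proof eventually_elim
      case (elim k)
      \<comment> \<open>The argument \<open>V (n - \<mu> k)\<close> moves with \<open>k\<close>;
        \<open>G_equi\<close> replaces it by the fixed argument \<open>U n\<close>, for which the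
        return limit is known.\<close>
      have "?N (G (V (n - \<mu> k)) (n - \<mu> k) - G (U n) (n - \<mu> k)) \<le> e / 2"
        by (rule G_equi[OF UD VD]) (rule less_imp_le[OF d(2)[OF VL elim(1)]])
      with elim(2) show ?case
        using tri[OF GL[OF VD[of "n - \<mu> k"], of "n - \<mu> k"] GL[OF UD[of n], of "n - \<mu> k"] F_in_Lp[OF UL[of n], of n]]
        unfolding V'_def real_norm_def diff_0_right abs_of_nonneg[OF Lp_norm_nonneg] by linarith
    qed
    then show "\<exists>N. \<forall>k\<ge>N. norm (?N (V' (n - \<mu> k) - F n (U n)) - 0) < e"
      by (simp only: eventually_sequentially)
  qed
  moreover have "V' n \<in> Lp q 0 1" for n unfolding V'_def by (rule GL[OF VD])
  ultimately have "shift_limit q (m \<circ> (r1 \<circ> r2)) (\<lambda>n. F n (U n)) V'"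
    unfolding shift_limit_def \<mu>_def comp_assoc by blast
  moreover have "strict_mono (r1 \<circ> r2)" using r1(1) r2(1) by (rule strict_mono_o)
  ultimately show "\<exists>r. strict_mono r \<and> (\<exists>V. shift_limit q (m \<circ> r) (\<lambda>n. F n (U n)) V)" by blast
qed

section \<open>Mapping property and continuity on Stepanov almost automorphic functions\<close>

lemma nemytskii_in_Spaa:
  assumes "u \<in> Spaa p"
  shows "nemytskii f u \<in> Spaa q"
  using aa_seq_F_seq assms unfolding Spaa_iff_aa_seq[OF p] Spaa_iff_aa_seq[OF q] bochner_transform_nemytskii by blast

text \<open>The radius of equicontinuity depends on the point, so a failure of continuity is traced
  to pieces of \<open>u\<close> that converge along a subsequence; equicontinuity at their limit
  controls the nearby pieces of both \<open>u\<close> and \<open>v\<close>.\<close>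

lemma nemytskii_continuous_on_Spaa:
  "seminorm_continuous_on (Spaa p) (Sp_norm p) (Sp_norm q) (nemytskii f)"
  unfolding seminorm_continuous_on_def
proof (intro ballI allI impI, rule ccontr)
  fix u and e :: real assume u: "u \<in> Spaa p" and e: "e > 0"
    and "\<not> (\<exists>\<delta>>0. \<forall>v\<in>Spaa p. Sp_norm p (v - u) < \<delta> \<longrightarrow> Sp_norm q (nemytskii f v - nemytskii f u) < e)"
  then have "\<exists>v\<in>Spaa p. Sp_norm p (v - u) < inverse (real (Suc j)) \<and> \<not> Sp_norm q (nemytskii f v - nemytskii f u) < e" for j
    by (metis inverse_positive_iff_positive of_nat_0_less_iff zero_less_Suc)
  then obtain v where v: "\<And>j. v j \<in> Spaa p" "\<And>j. Sp_norm p (v j - u) < inverse (real (Suc j))"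
      "\<And>j. \<not> Sp_norm q (nemytskii f (v j) - nemytskii f u) < e"
    by metis
  let ?U = "\<lambda>n. bochner_transform u (of_int n)" and ?V = "\<lambda>j n. bochner_transform (v j) (of_int n)"
  have loc: "w \<in> Lp_loc s" if "w \<in> Spaa s" for w :: "real \<Rightarrow> 'b::banach" and s using that by (simp add: Spaa_def)
  \<comment> \<open>If all integer pieces were closer than \<open>e / 3\<close>, the Stepanov
    distance would be at most \<open>2 * (e / 3) < e\<close>.\<close>
  have "\<exists>n::int. e / 3 \<le> Lp_norm q 0 1 (F n (?V j n) - F n (?U n))" for j
  proof (rule ccontr)
    assume "\<not> ?thesis"
    then have "Sp_norm q (nemytskii f (v j) - nemytskii f u) \<le> 2 * (e / 3)"
      unfolding bochner_transform_nemytskii[symmetric]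
      by (intro Sp_norm_leI q loc nemytskii_in_Spaa u v) (auto simp: not_le intro: less_imp_le)
    then show False using v(3)[of j] e by simp
  qed
  then obtain n where n: "\<And>j. e / 3 \<le> Lp_norm q 0 1 (F (n j) (?V j (n j)) - F (n j) (?U (n j)))" by metis
  obtain r W where r: "strict_mono r" and W: "shift_limit p (n \<circ> r) ?U W"
    using u unfolding Spaa_iff_aa_seq[OF p] aa_seq_def by blast
  \<comment> \<open>At time 0 the shift limit is the limit of the pieces \<open>n (r k)\<close> of
    \<open>u\<close> themselves.\<close>
  let ?w = "W 0"
  have w: "?w \<in> Lp p 0 1" by (rule shift_limitD(1)[OF W])
  have UL: "?U i \<in> Lp p 0 1" and VL: "?V j i \<in> Lp p 0 1" for i j
    by (intro bochner_transform_in_Lp loc u v)+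
  have lim: "(\<lambda>k. Lp_norm p 0 1 (?U (n (r k)) - ?w)) \<longlonglongrightarrow> 0"
    using shift_limitD(2)[OF W, of 0] by simp
  have e6: "e / 6 > 0" using e by simp
  obtain d where d: "d > 0"
    "\<And>w' i. w' \<in> Lp p 0 1 \<Longrightarrow> Lp_norm p 0 1 (w' - ?w) < d \<Longrightarrow> Lp_norm q 0 1 (F i w' - F i ?w) < e / 6"
    by (rule F_equicontinuous[OF w e6], rule that)
  have "\<forall>\<^sub>F k in sequentially. Lp_norm p 0 1 (?U (n (r k)) - ?w) < d / 2"
    by (rule order_tendstoD(2)[OF lim half_gt_zero[OF d(1)]])
  moreover have "\<forall>\<^sub>F k in sequentially. inverse (real (Suc k)) < d / 2"
    by (rule order_tendstoD(2)[OF LIMSEQ_inverse_real_of_nat half_gt_zero[OF d(1)]])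
  ultimately have "\<forall>\<^sub>F k in sequentially. False"
  proof eventually_elim
    case (elim k)
    let ?j = "r k" and ?i = "n (r k)"
    have "inverse (real (Suc ?j)) \<le> inverse (real (Suc k))"
      using seq_suble[OF r, of k] by (intro le_imp_inverse_le) auto
    moreover have "Lp_norm p 0 1 (?V ?j ?i - ?U ?i) \<le> Sp_norm p (v ?j - u)"
      by (intro Lp_norm_le_Sp_norm p Spaa_subset_BSp u v)
    ultimately have "Lp_norm p 0 1 (?V ?j ?i - ?w) < d"
      using Lp_norm_triangle[OF p VL[of ?j ?i] UL[of ?i] w] v(2)[of ?j] elim by linarith
    then have 1: "Lp_norm q 0 1 (F ?i (?V ?j ?i) - F ?i ?w) < e / 6"
      by (rule d(2)[OF VL])
    have "Lp_norm p 0 1 (?U ?i - ?w) < d" using elim(1) d(1) by linarith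
    then have 2: "Lp_norm q 0 1 (F ?i (?U ?i) - F ?i ?w) < e / 6"
      by (rule d(2)[OF UL])
    \<comment> \<open>Both images lie within \<open>e / 6\<close> of \<open>F ?i ?w\<close>, against
      the distance of at least \<open>e / 3\<close> between them.\<close>
    show False
      using Lp_norm_triangle[OF q F_in_Lp[OF VL[of ?j ?i], of ?i] F_in_Lp[OF w, of ?i] F_in_Lp[OF UL[of ?i], of ?i]]
        1 2 n[of ?j] Lp_norm_commute[of q 0 1 "F ?i ?w" "F ?i (?U ?i)"] by linarith
  qed
  then show False by simp
qed

end

section \<open>Equivalence of the three assertions\<close>

theorem theorem4p1:
  fixes f :: "real \<times> 'x::banach \<Rightarrow> 'y::banach" and p q :: real
  assumes "1 \<le> p" and "1 \<le> q"
  shows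
    "(((\<forall>u \<in> Spaa p. nemytskii f u \<in> Spaa q) \<and>
       seminorm_continuous_on (Spaa p) (Sp_norm p) (Sp_norm q) (nemytskii f))
      \<longleftrightarrow>
      ((\<forall>u \<in> Lp_periodic p. nemytskii f u \<in> Spaa q) \<and>
       seminorm_continuous_on (Lp_periodic p) (Sp_norm p) (Sp_norm q) (nemytskii f)))
     \<and>
     (((\<forall>u \<in> Lp_periodic p. nemytskii f u \<in> Spaa q) \<and>
       seminorm_continuous_on (Lp_periodic p) (Sp_norm p) (Sp_norm q) (nemytskii f))
      \<longleftrightarrow>
      ((\<forall>x. (\<lambda>t. f (t, x)) \<in> Spaa q) \<and>
       (\<forall>u \<in> Lp_periodic p. nemytskii f u \<in> BSp q) \<and>
       seminorm_continuous_on (Lp_periodic p) (Sp_norm p) (Sp_norm q) (nemytskii f)))"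
    (is "(?i \<longleftrightarrow> ?ii) \<and> (?ii \<longleftrightarrow> ?iii)")
proof -
  have sub: "Lp_periodic p \<subseteq> (Spaa p :: (real \<Rightarrow> 'x) set)"
    using Lp_periodic_subset_Spaa[OF assms(1)] by blast
  have "?i \<Longrightarrow> ?ii"
    using sub unfolding seminorm_continuous_on_def by (meson subsetD)
  moreover have "?ii \<Longrightarrow> ?iii"
  proof -
    assume ii: ?ii
    \<comment> \<open>Constants are periodic, and the superposition at a constant is the section of
      \<open>f\<close> that assertion (iii) refers to.\<close>
    have "nemytskii f (\<lambda>_. x) \<in> Spaa q" for x
      using ii const_in_Lp_periodic[OF assms(1)] by blast
    then have "(\<lambda>t. f (t, x)) \<in> Spaa q" for x
      by (simp add: nemytskii_def)
    with ii show ?iii using Spaa_subset_BSp[OF assms(2)] by blast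
  qed
  moreover have "?iii \<Longrightarrow> ?i"
  proof -
    assume ?iii
    then interpret nemytskii_on_periodic f p q
      using assms by unfold_locales auto
    show ?i using nemytskii_in_Spaa nemytskii_continuous_on_Spaa by blast
  qed
  ultimately show ?thesis by blast
qed

end
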